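(* Let $G\subset \mathbb{C}$ be a simply connected domain, $\sigma_0\in\mathbb{N}$ and $a\in\mathbb{C}\setminus \{-1\}$. If $G\cap (a+1)G=\emptyset$, then the sequence of linear operators $D_{n,a}: H(G)\to [H(G)]^{\sigma_0}$, $n=1,2,\ldots$, with $D_{n,a}(f)=(T_{a,n}(f),T_{a,n^2}(f),\ldots ,T_{a,n^{\sigma_0}}(f))$ is universal.
   Context: $H(G)$ denotes the space of holomorphic functions on $G$ endowed with the topology of uniform convergence on compact subsets of $G$. For $n\in\mathbb{N}$ and $a\in\mathbb{C}\setminus\{-1\}$, the operator $T_{a,n}: H(G)\to H(G)$ is defined by $T_{a,n}(f)(\zeta)=\sum_{j=0}^{n}\dfrac{f^{(j)}(\zeta)}{j!}(a\zeta)^j$, $\zeta\in G$. The set $(a+1)G$ is $\{(a+1)z: z\in G\}$. A sequence of continuous linear operators $T_n:X\to Y$, $n=1,2,\ldots$, between topological vector spaces is called universal if there exists $x_0\in X$ such that the set $\{T_nx_0: n\in\mathbb{N}\}$ is dense in $Y$. Products of spaces carry the product topology. *)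

theory Defs
  imports "HOL-Complex_Analysis.Complex_Analysis"
begin

text \<open>
  A complex topological vector space on a carrier set, the carrier being the \<^const>\<open>topspace\<close>
  of the topology. The vector space operations are relevant only on the carrier.
\<close>

record 'a tvs =
  tvs_top :: "'a topology"
  tvs_add :: "'a \<Rightarrow> 'a \<Rightarrow> 'a"
  tvs_scale :: "complex \<Rightarrow> 'a \<Rightarrow> 'a"

definition continuous_linear_op :: "'a tvs \<Rightarrow> 'b tvs \<Rightarrow> ('a \<Rightarrow> 'b) \<Rightarrow> bool" where
  "continuous_linear_op X Y T \<longleftrightarrow>
     continuous_map (tvs_top X) (tvs_top Y) T \<and>
     (\<forall>x\<in>topspace (tvs_top X). \<forall>y\<in>topspace (tvs_top X).
        T (tvs_add X x y) = tvs_add Y (T x) (T y)) \<and>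
     (\<forall>c. \<forall>x\<in>topspace (tvs_top X). T (tvs_scale X c x) = tvs_scale Y c (T x))"

text \<open>Sequences of operators are indexed by \<open>n = 1, 2, \<dots>\<close>; the value at \<open>n = 0\<close> is ignored.\<close>

definition universal_seq :: "'a tvs \<Rightarrow> 'b tvs \<Rightarrow> (nat \<Rightarrow> 'a \<Rightarrow> 'b) \<Rightarrow> bool" where
  "universal_seq X Y T \<longleftrightarrow>
     (\<forall>n\<ge>1. continuous_linear_op X Y (T n)) \<and>
     (\<exists>x\<in>topspace (tvs_top X).
        tvs_top Y closure_of {T n x | n. n \<ge> 1} = topspace (tvs_top Y))"

text \<open>
  Functions on \<open>G\<close> are represented by extensional functions on \<open>complex\<close>
  (with value \<^const>\<open>undefined\<close> outside \<open>G\<close>), so that equality is equality on \<open>G\<close>.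
\<close>

definition hol_funs :: "complex set \<Rightarrow> (complex \<Rightarrow> complex) set" where
  "hol_funs G = {f \<in> extensional G. f holomorphic_on G}"

definition hol_open :: "complex set \<Rightarrow> (complex \<Rightarrow> complex) set \<Rightarrow> bool" where
  "hol_open G U \<longleftrightarrow> U \<subseteq> hol_funs G \<and>
     (\<forall>f\<in>U. \<exists>K e. compact K \<and> K \<subseteq> G \<and> e > 0 \<and>
        {g \<in> hol_funs G. \<forall>z\<in>K. dist (g z) (f z) < e} \<subseteq> U)"

text \<open>The topology of uniform convergence on compact subsets of \<open>G\<close>.\<close>

definition hol_topology :: "complex set \<Rightarrow> (complex \<Rightarrow> complex) topology" where
  "hol_topology G = topology (hol_open G)"

lemma istopology_hol_open: "istopology (hol_open G)"
  unfolding istopology_def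
proof (intro conjI allI impI)
  fix S T assume S: "hol_open G S" and T: "hol_open G T"
  show "hol_open G (S \<inter> T)"
    unfolding hol_open_def
  proof (intro conjI ballI)
    show "S \<inter> T \<subseteq> hol_funs G" using S by (auto simp: hol_open_def)
    fix f assume f: "f \<in> S \<inter> T"
    obtain K d where K: "compact K" "K \<subseteq> G" "d > 0"
      "{g \<in> hol_funs G. \<forall>z\<in>K. dist (g z) (f z) < d} \<subseteq> S"
      using S f unfolding hol_open_def by blast
    obtain L e where L: "compact L" "L \<subseteq> G" "e > 0"
      "{g \<in> hol_funs G. \<forall>z\<in>L. dist (g z) (f z) < e} \<subseteq> T"
      using T f unfolding hol_open_def by blast
    have "{g \<in> hol_funs G. \<forall>z\<in>K \<union> L. dist (g z) (f z) < min d e} \<subseteq> S \<inter> T"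
      using K(4) L(4) by auto
    then show "\<exists>K e. compact K \<and> K \<subseteq> G \<and> e > 0 \<and>
        {g \<in> hol_funs G. \<forall>z\<in>K. dist (g z) (f z) < e} \<subseteq> S \<inter> T"
      using K(1-3) L(1-3)
      by (intro exI[of _ "K \<union> L"] exI[of _ "min d e"]) (auto intro: compact_Un)
  qed
next
  fix \<U> assume U: "\<forall>S\<in>\<U>. hol_open G S"
  show "hol_open G (\<Union>\<U>)"
    unfolding hol_open_def
  proof (intro conjI ballI)
    show "\<Union>\<U> \<subseteq> hol_funs G" using U by (auto simp: hol_open_def)
    fix f assume "f \<in> \<Union>\<U>"
    then obtain S where S: "S \<in> \<U>" "f \<in> S" by blast
    then obtain K e where "compact K" "K \<subseteq> G" "e > 0"
      "{g \<in> hol_funs G. \<forall>z\<in>K. dist (g z) (f z) < e} \<subseteq> S"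
      using U unfolding hol_open_def by meson
    then show "\<exists>K e. compact K \<and> K \<subseteq> G \<and> e > 0 \<and>
        {g \<in> hol_funs G. \<forall>z\<in>K. dist (g z) (f z) < e} \<subseteq> \<Union>\<U>"
      using S by blast
  qed
qed

lemma openin_hol_topology: "openin (hol_topology G) U \<longleftrightarrow> hol_open G U"
  by (simp add: hol_topology_def istopology_hol_open)

lemma topspace_hol_topology: "topspace (hol_topology G) = hol_funs G"
proof -
  have "hol_open G (hol_funs G)"
    unfolding hol_open_def by (auto intro!: exI[of _ "{}"] exI[of _ "1::real"])
  then show ?thesis
    unfolding topspace_def openin_hol_topology by (auto simp: hol_open_def)
qed

definition H_space :: "complex set \<Rightarrow> (complex \<Rightarrow> complex) tvs" where
  "H_space G =
     \<lparr>tvs_top = hol_topology G,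
      tvs_add = (\<lambda>f g. \<lambda>z\<in>G. f z + g z),
      tvs_scale = (\<lambda>c f. \<lambda>z\<in>G. c * f z)\<rparr>"

text \<open>The power \<open>X\<^sup>s\<close>, with coordinates indexed by \<open>1, \<dots>, s\<close>.\<close>

definition tvs_power :: "'a tvs \<Rightarrow> nat \<Rightarrow> (nat \<Rightarrow> 'a) tvs" where
  "tvs_power X s =
     \<lparr>tvs_top = product_topology (\<lambda>_. tvs_top X) {1..s},
      tvs_add = (\<lambda>x y. \<lambda>i\<in>{1..s}. tvs_add X (x i) (y i)),
      tvs_scale = (\<lambda>c x. \<lambda>i\<in>{1..s}. tvs_scale X c (x i))\<rparr>"

definition taylor_op ::
    "complex set \<Rightarrow> complex \<Rightarrow> nat \<Rightarrow> (complex \<Rightarrow> complex) \<Rightarrow> (complex \<Rightarrow> complex)" where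
  "taylor_op G a n f = (\<lambda>\<zeta>\<in>G. \<Sum>j=0..n. (deriv ^^ j) f \<zeta> / fact j * (a * \<zeta>) ^ j)"

definition D_op ::
    "complex set \<Rightarrow> complex \<Rightarrow> nat \<Rightarrow> nat \<Rightarrow> (complex \<Rightarrow> complex) \<Rightarrow> (nat \<Rightarrow> complex \<Rightarrow> complex)" where
  "D_op G a s n f = (\<lambda>i\<in>{1..s}. taylor_op G a (n ^ i) f)"

end

theory Submission
  imports Defs
begin

text \<open>
  Write \<open>T\<^sub>n f (\<zeta>)\<close> for the operator \<open>taylor_op G a n\<close>. It is the \<open>n\<close>-th Taylor sum of \<open>f\<close> about \<open>\<zeta>\<close>,
  evaluated at the point \<open>\<zeta> + a \<zeta> = (a + 1) \<zeta>\<close>. By hypothesis this point lies outside \<open>G\<close>, so the values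
  of an approximating polynomial near \<open>G\<close> and its values near \<open>(a + 1) G\<close> can be prescribed
  independently; and for a polynomial \<open>p\<close> of degree at most \<open>n\<close>, \<open>T\<^sub>n p (\<zeta>) = p ((a + 1) \<zeta>)\<close>.

  By Baire's theorem in \<open>H(G)\<close> (\<open>baire_hol_open\<close>) and separability of \<open>H(G)\<close>, universality follows from
  one density statement (\<open>simultaneous_taylor_approximation\<close>): every \<open>f\<close> in \<open>H(G)\<close> is approximated on a
  compact set \<open>K\<close> by polynomials \<open>P\<close> for which, for some \<open>n\<close>, the functions \<open>T\<^sub>n P, T\<^bsub>n^2\<^esub> P, \<dots>, T\<^bsub>n^s\<^esub> P\<close>
  are close on \<open>K\<close> to given polynomials \<open>h\<^sub>1, \<dots>, h\<^sub>s\<close>.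

  For this, enlarge \<open>K\<close> to a compact \<open>L\<close> in \<open>G\<close> with connected complement and put \<open>S = (a + 1) L\<close>. Runge's
  theorem (\<open>runge_simply_connected\<close>) yields a polynomial \<open>H\<^sub>0\<close> close to \<open>f\<close> on \<open>L\<close> and a polynomial \<open>u\<close> that
  is near \<open>0\<close> on \<open>L\<close> and near \<open>1\<close> on \<open>S\<close>. Let \<open>H\<^sub>i (w) = h\<^sub>i (w / (a + 1))\<close> for \<open>i \<ge> 1\<close> and take
    \<open>P = H\<^sub>0 + (\<Sum>i = 1..s. (H\<^sub>i - H\<^bsub>i-1\<^esub>) * \<beta>\<^sub>i (u))\<close>,
  where \<open>\<beta>\<^sub>i\<close> is a polynomial in one variable with \<open>\<beta>\<^sub>i (u) \<approx> 0\<close> on \<open>L\<close> and \<open>\<beta>\<^sub>i (u) \<approx> 1\<close> on \<open>S\<close>.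
  The summand with index \<open>i\<close> has degree at most \<open>n^i\<close>, the degree of \<open>\<beta>\<^sub>i\<close> is proportional to \<open>n^i\<close>, and
  the decisive point is that the error of \<open>\<beta>\<^sub>i (u)\<close> is exponentially small in that degree (\<open>step_poly\<close>).
  Hence \<open>T\<^bsub>n^j\<^esub>\<close> evaluates the summands with \<open>i \<le> j\<close> exactly at the points of \<open>S\<close>, where together with
  \<open>H\<^sub>0\<close> they telescope to \<open>H\<^sub>j\<close> up to a small error. On the summands with \<open>i > j\<close>, Cauchy's inequalities cost
  a factor of only \<open>B ^ (n^j)\<close>, up to a linear factor, which is beaten by an error exponentially
  small in \<open>n^i\<close>.

  Runge's theorem is obtained directly from the Riemann map \<open>\<phi>\<close> of the unit disc onto \<open>G\<close>: substituting
  \<open>\<phi>\<close> in the Cauchy integral over a circle represents \<open>f\<close> on \<open>\<phi>\<close> of a smaller disc, and the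
  same integral vanishes off \<open>G\<close>. Riemann sums and pole pushing turn it into polynomials.
\<close>

section \<open>Uniform limits of polynomials and pole pushing\<close>

definition poly_approximable :: "complex set \<Rightarrow> (complex \<Rightarrow> complex) \<Rightarrow> bool" where
  "poly_approximable S g \<longleftrightarrow> (\<forall>e>0. \<exists>p. \<forall>z\<in>S. norm (poly p z - g z) < e)"

lemma poly_approximableD:
  assumes "poly_approximable S g" "e > 0"
  obtains p where "\<And>z. z \<in> S \<Longrightarrow> norm (poly p z - g z) < e"
  using assms unfolding poly_approximable_def by blast

lemma poly_approximable_poly: "poly_approximable S (poly p)"
  unfolding poly_approximable_def by (metis cancel_comm_monoid_add_class.diff_cancel norm_zero)

lemma poly_approximable_const: "poly_approximable S (\<lambda>z. c)"
proof -
  have "poly [:c:] = (\<lambda>z. c)" by auto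
  then show ?thesis using poly_approximable_poly[of S "[:c:]"] by simp
qed

lemma poly_approximable_ident: "poly_approximable S (\<lambda>z. z)"
proof -
  have "poly [:0, 1:] = (\<lambda>z::complex. z)" by auto
  then show ?thesis using poly_approximable_poly[of S "[:0,1:]"] by simp
qed

lemma poly_approximable_limit:
  assumes "\<And>e. e > 0 \<Longrightarrow> \<exists>h. poly_approximable S h \<and> (\<forall>z\<in>S. norm (h z - g z) < e)"
  shows "poly_approximable S g"
  unfolding poly_approximable_def
proof (intro allI impI)
  fix e :: real assume "e > 0"
  then obtain h where h: "poly_approximable S h" "\<And>z. z \<in> S \<Longrightarrow> norm (h z - g z) < e/2"
    using assms[of "e/2"] by auto
  obtain p where p: "\<And>z. z \<in> S \<Longrightarrow> norm (poly p z - h z) < e/2"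
    by (rule poly_approximableD[OF h(1), of "e/2"]) (use \<open>e > 0\<close> in auto)
  have "norm (poly p z - g z) < e" if "z \<in> S" for z
    using norm_triangle_lt[of "poly p z - h z" "h z - g z" e] p[OF that] h(2)[OF that] by simp
  then show "\<exists>p. \<forall>z\<in>S. norm (poly p z - g z) < e" by (intro exI[of _ p] ballI)
qed

lemma poly_approximable_cong:
  "poly_approximable S f \<Longrightarrow> (\<And>z. z \<in> S \<Longrightarrow> f z = g z) \<Longrightarrow> poly_approximable S g"
  by (simp add: poly_approximable_def)

lemma poly_approximable_bounded:
  assumes "compact S" "poly_approximable S g"
  obtains M where "M > 0" "\<And>z. z \<in> S \<Longrightarrow> norm (g z) \<le> M"
proof -
  obtain p where p: "\<And>z. z \<in> S \<Longrightarrow> norm (poly p z - g z) < 1"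
    by (rule poly_approximableD[OF assms(2) zero_less_one]) auto
  have "continuous_on S (poly p)"
    by (simp add: continuous_at_imp_continuous_on)
  then have "bounded (poly p ` S)"
    by (intro compact_imp_bounded compact_continuous_image assms)
  then obtain B where B: "\<And>z. z \<in> S \<Longrightarrow> norm (poly p z) \<le> B"
    unfolding bounded_iff by auto
  have "norm (g z) \<le> \<bar>B\<bar> + 1" if "z \<in> S" for z
    using norm_triangle_ineq4[of "poly p z" "poly p z - g z"] p[OF that] B[OF that] by simp
  moreover have "\<bar>B\<bar> + 1 > 0" by simp
  ultimately show ?thesis by (rule that[rotated])
qed

lemma poly_approximable_add:
  assumes "poly_approximable S f" "poly_approximable S g"
  shows "poly_approximable S (\<lambda>z. f z + g z)"
  unfolding poly_approximable_def
proof (intro allI impI)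
  fix e :: real assume "e > 0"
  then have e: "e/2 > 0" by simp
  obtain p where p: "\<And>z. z \<in> S \<Longrightarrow> norm (poly p z - f z) < e/2"
    by (rule poly_approximableD[OF assms(1) e]) auto
  obtain q where q: "\<And>z. z \<in> S \<Longrightarrow> norm (poly q z - g z) < e/2"
    by (rule poly_approximableD[OF assms(2) e]) auto
  have "norm (poly (p + q) z - (f z + g z)) < e" if "z \<in> S" for z
    using norm_triangle_lt[of "poly p z - f z" "poly q z - g z" e] p[OF that] q[OF that]
    by (simp add: algebra_simps)
  then show "\<exists>p. \<forall>z\<in>S. norm (poly p z - (f z + g z)) < e" by (intro exI[of _ "p + q"] ballI)
qed

lemma poly_approximable_mult:
  assumes S: "compact S" and f: "poly_approximable S f" and g: "poly_approximable S g"
  shows "poly_approximable S (\<lambda>z. f z * g z)"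
  unfolding poly_approximable_def
proof (intro allI impI)
  fix e :: real assume "e > 0"
  obtain A where A: "A > 0" "\<And>z. z \<in> S \<Longrightarrow> norm (f z) \<le> A"
    by (rule poly_approximable_bounded[OF S f]) auto
  obtain p where p: "\<And>z. z \<in> S \<Longrightarrow> norm (poly p z - g z) < e / (2 * A)"
    by (rule poly_approximableD[OF g, of "e / (2 * A)"]) (use \<open>e > 0\<close> A(1) in auto)
  obtain B where B: "B > 0" "\<And>z. z \<in> S \<Longrightarrow> norm (poly p z) \<le> B"
    by (rule poly_approximable_bounded[OF S poly_approximable_poly[of S p]]) auto
  obtain q where q: "\<And>z. z \<in> S \<Longrightarrow> norm (poly q z - f z) < e / (2 * B)"
    by (rule poly_approximableD[OF f, of "e / (2 * B)"]) (use \<open>e > 0\<close> B(1) in auto)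
  have "norm (poly (q * p) z - f z * g z) < e" if z: "z \<in> S" for z
  proof -
    have eq: "poly (q * p) z - f z * g z = (poly q z - f z) * poly p z + f z * (poly p z - g z)"
      by (simp add: algebra_simps)
    have "norm ((poly q z - f z) * poly p z) \<le> norm (poly q z - f z) * B"
      unfolding norm_mult by (intro mult_left_mono B z) simp
    also have "\<dots> < e / (2 * B) * B" by (intro mult_strict_right_mono q z B)
    finally have 1: "norm ((poly q z - f z) * poly p z) < e / 2" using B(1) by simp
    have "norm (f z * (poly p z - g z)) \<le> A * norm (poly p z - g z)"
      unfolding norm_mult by (intro mult_right_mono A z) simp
    also have "\<dots> < A * (e / (2 * A))" by (intro mult_strict_left_mono p z A)
    finally have 2: "norm (f z * (poly p z - g z)) < e / 2" using A(1) by simp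
    show ?thesis unfolding eq using norm_triangle_lt[OF add_strict_mono[OF 1 2]] by simp
  qed
  then show "\<exists>p. \<forall>z\<in>S. norm (poly p z - f z * g z) < e" by (intro exI[of _ "q * p"] ballI)
qed

lemma poly_approximable_sum:
  assumes "finite I" "\<And>i. i \<in> I \<Longrightarrow> poly_approximable S (f i)"
  shows "poly_approximable S (\<lambda>z. \<Sum>i\<in>I. f i z)"
  using assms
proof (induction I rule: finite_induct)
  case empty
  then show ?case using poly_approximable_const[of S 0] by simp
next
  case (insert i I)
  have "poly_approximable S (f i)" by (rule insert.prems) simp
  moreover have "poly_approximable S (\<lambda>z. \<Sum>i\<in>I. f i z)"
    by (rule insert.IH, rule insert.prems) simp
  ultimately have "poly_approximable S (\<lambda>z. f i z + (\<Sum>i\<in>I. f i z))"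
    by (rule poly_approximable_add)
  then show ?case using insert.hyps by simp
qed

lemma poly_approximable_power:
  assumes "compact S" "poly_approximable S f"
  shows "poly_approximable S (\<lambda>z. f z ^ n)"
proof (induction n)
  case 0
  then show ?case using poly_approximable_const[of S 1] by simp
next
  case (Suc n)
  then show ?case unfolding power_Suc by (rule poly_approximable_mult[OF assms])
qed

text \<open>
  Since \<open>norm (b z) \<le> 1/2\<close>, the geometric series in \<open>b\<close> converges uniformly. This is the only source of
  non-polynomial approximable functions; both the shift of a pole and its arrival from infinity are
  instances of it.
\<close>

lemma poly_approximable_inverse_one_minus:
  assumes S: "compact S" and b: "poly_approximable S b" and half: "\<And>z. z \<in> S \<Longrightarrow> norm (b z) \<le> 1/2"
  shows "poly_approximable S (\<lambda>z. 1 / (1 - b z))"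
proof (rule poly_approximable_limit)
  fix e :: real assume "e > 0"
  have "\<exists>n. (1/2::real) ^ n < e / 2"
    by (rule real_arch_pow_inv) (use \<open>e > 0\<close> in simp_all)
  then obtain n where n: "(1/2::real) ^ n < e / 2" ..
  have "norm ((\<Sum>i<n. b z ^ i) - 1 / (1 - b z)) < e" if z: "z \<in> S" for z
  proof -
    have ne: "b z \<noteq> 1" using half[OF z] by auto
    have "(\<Sum>i<n. b z ^ i) - 1 / (1 - b z) = - (b z ^ n / (1 - b z))"
      using ne unfolding sum_gp_strict by (simp add: diff_divide_distrib)
    moreover have "norm (b z ^ n / (1 - b z)) \<le> (1/2) ^ n / (1/2)"
      unfolding norm_divide norm_power
    proof (rule frac_le)
      show "norm (b z) ^ n \<le> (1/2) ^ n" by (rule power_mono[OF half[OF z] norm_ge_zero])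
      show "1/2 \<le> norm (1 - b z)" using norm_triangle_ineq2[of 1 "b z"] half[OF z] by simp
    qed simp_all
    ultimately have "norm ((\<Sum>i<n. b z ^ i) - 1 / (1 - b z)) \<le> (1/2) ^ n / (1/2)"
      by (simp only: norm_minus_cancel)
    also have "\<dots> < e" using n by simp
    finally show ?thesis .
  qed
  moreover have "poly_approximable S (\<lambda>z. \<Sum>i<n. b z ^ i)"
    by (rule poly_approximable_sum[OF finite_lessThan poly_approximable_power[OF S b]])
  ultimately show "\<exists>h. poly_approximable S h \<and> (\<forall>z\<in>S. norm (h z - 1 / (1 - b z)) < e)"
    by blast
qed

text \<open>
  The points \<open>w\<close> off \<open>S\<close> for which \<open>1 / (w - z)\<close> is approximable form an open and closed subset of the
  connected set \<open>- S\<close>: expanding \<open>1 / (y - z)\<close> in powers of \<open>(x - y) / (x - z)\<close> moves the pole from \<open>x\<close>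
  to \<open>y\<close> whenever the step is at most half the distance of \<open>x\<close> to \<open>S\<close>. The subset is nonempty because
  a pole of large modulus can be expanded in powers of \<open>z\<close>.
\<close>

lemma pole_pushing:
  fixes S :: "complex set"
  assumes S: "compact S" and conn: "connected (- S)" and w: "w \<notin> S"
  shows "poly_approximable S (\<lambda>z. 1 / (w - z))"
proof -
  obtain R where R: "R > 0" "\<And>z. z \<in> S \<Longrightarrow> norm z \<le> R"
    using compact_imp_bounded[OF S] unfolding bounded_pos by blast
  define c where "c = complex_of_real (2 * R)"
  have c: "norm c = 2 * R" "c \<noteq> 0" using R(1) by (auto simp: c_def)
  have cS: "c \<in> - S" using R(2)[of c] R(1) c(1) by force
  have shift: "poly_approximable S (\<lambda>z. 1 / (y - z))"
    if x: "poly_approximable S (\<lambda>z. 1 / (x - z))" and close: "\<And>z. z \<in> S \<Longrightarrow> 2 * norm (x - y) \<le> norm (x - z)"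
      and "x \<notin> S" "y \<notin> S" for x y
  proof -
    have "poly_approximable S (\<lambda>z. 1 / (1 - (x - y) * (1 / (x - z))))"
    proof (rule poly_approximable_inverse_one_minus[OF S])
      show "poly_approximable S (\<lambda>z. (x - y) * (1 / (x - z)))"
        by (intro poly_approximable_mult S poly_approximable_const x)
      fix z assume z: "z \<in> S"
      then have "x - z \<noteq> 0" using \<open>x \<notin> S\<close> by auto
      then show "norm ((x - y) * (1 / (x - z))) \<le> 1/2"
        using close[OF z] by (simp add: norm_mult norm_divide divide_simps)
    qed
    then have "poly_approximable S (\<lambda>z. 1 / (x - z) * (1 / (1 - (x - y) * (1 / (x - z)))))"
      by (rule poly_approximable_mult[OF S x])
    then show ?thesis
    proof (rule poly_approximable_cong)
      fix z assume z: "z \<in> S"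
      then have "x - z \<noteq> 0" "y - z \<noteq> 0" using \<open>x \<notin> S\<close> \<open>y \<notin> S\<close> by auto
      moreover have "1 - (x - y) * (1 / (x - z)) = (y - z) / (x - z)"
        using \<open>x - z \<noteq> 0\<close> by (simp add: divide_simps)
      ultimately show "1 / (x - z) * (1 / (1 - (x - y) * (1 / (x - z)))) = 1 / (y - z)"
        by simp
    qed
  qed
  have base: "poly_approximable S (\<lambda>z. 1 / (c - z))"
  proof -
    have "poly_approximable S (\<lambda>z. 1 / (1 - (1/c) * z))"
    proof (rule poly_approximable_inverse_one_minus[OF S])
      show "poly_approximable S (\<lambda>z. 1 / c * z)"
        by (intro poly_approximable_mult S poly_approximable_const poly_approximable_ident)
      show "norm (1 / c * z) \<le> 1/2" if "z \<in> S" for z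
        using R(2)[OF that] R(1) c by (simp add: norm_divide divide_simps)
    qed
    then have "poly_approximable S (\<lambda>z. (1/c) * (1 / (1 - (1/c) * z)))"
      by (intro poly_approximable_mult S poly_approximable_const)
    then show ?thesis
      by (rule poly_approximable_cong) (use c in \<open>simp add: right_diff_distrib\<close>)
  qed
  show ?thesis
  proof (rule connected_induction_simple[OF conn, where P = "\<lambda>w. poly_approximable S (\<lambda>z. 1 / (w - z))"])
    show "c \<in> - S" "w \<in> - S" using cS w by auto
    show "poly_approximable S (\<lambda>z. 1 / (c - z))" by fact
    fix v assume v: "v \<in> - S"
    have "open (- S)" using S by (simp add: compact_imp_closed open_Compl)
    then obtain d where d: "d > 0" "ball v d \<subseteq> - S" using v open_contains_ball by blast
    have dd: "d \<le> norm (v - z)" if "z \<in> S" for z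
      using d(2) that by (force simp: dist_norm)
    \<comment> \<open>Two points of the ball of radius \<open>d / 8\<close> differ by less than \<open>d / 4\<close> and keep distance at least
      \<open>7 d / 8\<close> from \<open>S\<close>, so a pole may be shifted between them in either direction.\<close>
    show "\<exists>T. openin (top_of_set (- S)) T \<and> v \<in> T \<and>
          (\<forall>x\<in>T. \<forall>y\<in>T. poly_approximable S (\<lambda>z. 1 / (x - z)) \<longrightarrow> poly_approximable S (\<lambda>z. 1 / (y - z)))"
    proof (intro exI[of _ "ball v (d/8)"] conjI ballI impI)
      have sub: "ball v (d/8) \<subseteq> - S" using d by (force simp: subset_iff)
      then show "openin (top_of_set (- S)) (ball v (d / 8))"
        by (simp add: open_subset)
      show "v \<in> ball v (d/8)" using d by simp
      fix x y assume x: "x \<in> ball v (d/8)" and y: "y \<in> ball v (d/8)"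
        and px: "poly_approximable S (\<lambda>z. 1 / (x - z))"
      have "2 * norm (x - y) \<le> norm (x - z)" if "z \<in> S" for z
      proof -
        have "norm (x - y) < d/4"
          using dist_triangle_half_l[of x v "d/4" y] x y by (simp add: dist_norm norm_minus_commute)
        moreover have "norm (v - z) \<le> norm (v - x) + norm (x - z)"
          using norm_triangle_ineq[of "v - x" "x - z"] by simp
        moreover have "norm (v - x) < d/8" using x by (simp add: dist_norm)
        ultimately show ?thesis using dd[OF that] d(1) by linarith
      qed
      then show "poly_approximable S (\<lambda>z. 1 / (y - z))"
        by (rule shift[OF px]) (use sub x y in auto)
    qed
  qed
qed

section \<open>Runge's theorem for simply connected domains\<close>

text \<open>
  The integrand is uniformly continuous in both variables, so one partition serves all parameters \<open>z\<close>.
\<close>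

lemma uniform_riemann_sum:
  fixes k :: "real \<Rightarrow> 'a::metric_space \<Rightarrow> 'b::banach"
  assumes S: "compact S" and cont: "continuous_on ({0..1} \<times> S) (\<lambda>(t, z). k t z)" and "e > 0"
  obtains N :: nat where "N > 0"
    "\<And>z. z \<in> S \<Longrightarrow> norm (integral {0..1} (\<lambda>t. k t z) - (\<Sum>j<N. (1 / real N) *\<^sub>R k (real j / real N) z)) \<le> e"
proof -
  have "uniformly_continuous_on ({0..1} \<times> S) (\<lambda>(t, z). k t z)"
    by (intro compact_uniformly_continuous cont compact_Times S) simp
  then obtain d where d: "d > 0" and
    D: "\<forall>x\<in>{0..1} \<times> S. \<forall>y\<in>{0..1} \<times> S. dist y x < d \<longrightarrow>
          dist ((\<lambda>(t, z). k t z) y) ((\<lambda>(t, z). k t z) x) < e"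
    unfolding uniformly_continuous_on_def using \<open>e > 0\<close> by meson
  have close: "norm (k t z - k t' z) < e"
    if "t \<in> {0..1}" "t' \<in> {0..1}" "z \<in> S" "\<bar>t - t'\<bar> < d" for t t' z
    using D[rule_format, of "(t', z)" "(t, z)"] that by (simp add: dist_Pair_Pair dist_norm)
  obtain n where "inverse (real (Suc n)) < d"
    using reals_Archimedean[OF d] by blast
  then obtain N :: nat where N: "N > 0" "1 / real N < d"
    by (intro that[of "Suc n"]) (simp_all add: inverse_eq_divide)
  have contz: "continuous_on {0..1} (\<lambda>t. k t z)" if "z \<in> S" for z
  proof -
    have "continuous_on {0..1} (\<lambda>t. (t, z))"
      by (rule continuous_on_Pair[OF continuous_on_id continuous_on_const])
    then have "continuous_on {0..1} (\<lambda>t. (\<lambda>(t, z). k t z) (t, z))"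
      by (rule continuous_on_compose2[OF cont]) (use that in auto)
    then show ?thesis by simp
  qed
  have part: "norm (integral {0..real m / real N} (\<lambda>t. k t z) - (\<Sum>j<m. (1 / real N) *\<^sub>R k (real j / real N) z))
      \<le> real m * (e / real N)" if z: "z \<in> S" and "m \<le> N" for z m
    using \<open>m \<le> N\<close>
  proof (induction m)
    case (Suc m)
    define a where "a = real m / real N"
    define b where "b = real (Suc m) / real N"
    have ab: "0 \<le> a" "a \<le> b" "b \<le> 1" "b - a = 1 / real N"
      using N(1) Suc.prems by (auto simp: a_def b_def divide_simps)
    have int: "(\<lambda>t. k t z) integrable_on {0..b}"
      by (intro integrable_continuous_real continuous_on_subset[OF contz[OF z]]) (use ab in auto)
    have contab: "continuous_on {a..b} (\<lambda>t. k t z)"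
      by (intro continuous_on_subset[OF contz[OF z]]) (use ab in auto)
    have split: "integral {0..b} (\<lambda>t. k t z) = integral {0..a} (\<lambda>t. k t z) + integral {a..b} (\<lambda>t. k t z)"
      using Henstock_Kurzweil_Integration.integral_combine[OF ab(1,2) int] by simp
    have "integral {a..b} (\<lambda>t. k t z - k a z) = integral {a..b} (\<lambda>t. k t z) - integral {a..b} (\<lambda>t. k a z)"
      by (rule Henstock_Kurzweil_Integration.integral_diff[OF integrable_continuous_real[OF contab]
            integrable_continuous_real[OF continuous_on_const]])
    then have diff: "integral {a..b} (\<lambda>t. k t z) - (1 / real N) *\<^sub>R k a z = integral {a..b} (\<lambda>t. k t z - k a z)"
      using ab by simp
    have "norm (integral {a..b} (\<lambda>t. k t z - k a z)) \<le> e * (b - a)"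
    proof (rule integral_bound[OF ab(2)])
      show "continuous_on {a..b} (\<lambda>t. k t z - k a z)" by (rule continuous_on_diff[OF contab continuous_on_const])
      show "norm (k t z - k a z) \<le> e" if "t \<in> {a..b}" for t
        using close[of t a z] that ab N(2) z by force
    qed
    then have 1: "norm (integral {a..b} (\<lambda>t. k t z) - (1 / real N) *\<^sub>R k a z) \<le> e / real N"
      using ab diff by simp
    have 2: "norm (integral {0..a} (\<lambda>t. k t z) - (\<Sum>j<m. (1 / real N) *\<^sub>R k (real j / real N) z))
      \<le> real m * (e / real N)"
      using Suc unfolding a_def by simp
    have "norm ((integral {0..a} (\<lambda>t. k t z) - (\<Sum>j<m. (1 / real N) *\<^sub>R k (real j / real N) z)) +
          (integral {a..b} (\<lambda>t. k t z) - (1 / real N) *\<^sub>R k a z)) \<le> real m * (e / real N) + e / real N"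
      by (rule norm_triangle_mono[OF 2 1])
    then show ?case
      using split unfolding a_def b_def by (simp add: algebra_simps add_divide_distrib)
  qed simp
  show ?thesis
  proof (rule that[OF N(1)])
    fix z assume "z \<in> S"
    then show "norm (integral {0..1} (\<lambda>t. k t z) - (\<Sum>j<N. (1 / real N) *\<^sub>R k (real j / real N) z)) \<le> e"
      using part[of z N] N(1) by simp
  qed
qed

text \<open>
  A Riemann sum of this integral is a finite combination of functions \<open>1 / (w - z)\<close> with poles on the
  curve, and each of these poles can be pushed to infinity.
\<close>

lemma poly_approximable_cauchy_transform:
  fixes w c :: "real \<Rightarrow> complex"
  assumes S: "compact S" and conn: "connected (- S)"
    and w: "continuous_on {0..1} w" "w ` {0..1} \<inter> S = {}" and c: "continuous_on {0..1} c"
  shows "poly_approximable S (\<lambda>z. integral {0..1} (\<lambda>t. c t / (w t - z)))"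
proof (rule poly_approximable_limit)
  fix e :: real assume "e > 0"
  have "continuous_on ({0..1} \<times> S) (\<lambda>x. c (fst x) / (w (fst x) - snd x))"
    by (intro continuous_intros continuous_on_compose2[OF w(1)] continuous_on_compose2[OF c]) (use w(2) in auto)
  then have "continuous_on ({0..1} \<times> S) (\<lambda>(t, z). c t / (w t - z))"
    by (simp add: case_prod_unfold)
  then obtain N :: nat where N: "N > 0"
    "\<And>z. z \<in> S \<Longrightarrow> norm (integral {0..1} (\<lambda>t. c t / (w t - z))
        - (\<Sum>j<N. (1 / real N) *\<^sub>R (c (real j / real N) / (w (real j / real N) - z)))) \<le> e/2"
    using uniform_riemann_sum[OF S, of "\<lambda>t z. c t / (w t - z)" "e/2"] \<open>e > 0\<close> by auto
  define h where "h = (\<lambda>z. \<Sum>j<N. (of_real (1 / real N) * c (real j / real N)) * (1 / (w (real j / real N) - z)))"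
  have "poly_approximable S h"
    unfolding h_def
  proof (intro poly_approximable_sum poly_approximable_mult S poly_approximable_const pole_pushing[OF S conn])
    fix j assume "j \<in> {..<N}"
    then have "real j / real N \<in> {0..1}" by auto
    then show "w (real j / real N) \<notin> S" using w(2) by blast
  qed auto
  moreover have "norm (h z - integral {0..1} (\<lambda>t. c t / (w t - z))) < e" if "z \<in> S" for z
  proof -
    have "h z = (\<Sum>j<N. (1 / real N) *\<^sub>R (c (real j / real N) / (w (real j / real N) - z)))"
      by (simp add: h_def scaleR_conv_of_real)
    then show ?thesis using N(2)[OF that] \<open>e > 0\<close> by (simp add: norm_minus_commute)
  qed
  ultimately show "\<exists>h. poly_approximable S h \<and> (\<forall>z\<in>S. norm (h z - integral {0..1} (\<lambda>t. c t / (w t - z))) < e)"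
    by blast
qed

text \<open>
  The complement is connected because a compact set homeomorphic to a convex one does not separate the
  plane.
\<close>

lemma conformal_closed_disc:
  fixes \<phi> :: "complex \<Rightarrow> complex"
  assumes hol: "\<phi> holomorphic_on ball 0 1" and inj: "inj_on \<phi> (ball 0 1)" and s: "s < 1"
  shows "compact (\<phi> ` cball 0 s)" "connected (- \<phi> ` cball 0 s)"
proof -
  define L where "L = \<phi> ` cball 0 s"
  have sub: "cball 0 s \<subseteq> ball (0::complex) 1" using s by auto
  have cont: "continuous_on (cball 0 s) \<phi>"
    by (rule continuous_on_subset[OF holomorphic_on_imp_continuous_on[OF hol] sub])
  show "compact (\<phi> ` cball 0 s)" by (rule compact_continuous_image[OF cont compact_cball])
  have "cball (0::complex) s homeomorphic L"
    using homeomorphic_compact[OF compact_cball cont L_def[symmetric] inj_on_subset[OF inj sub]] .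
  then have "L homeomorphic cball (0::complex) s"
    by (rule homeomorphic_sym[THEN iffD1])
  then have "connected (- L)"
    by (rule connected_complement_homeomorphic_convex_compact) simp_all
  then show "connected (- \<phi> ` cball 0 s)" by (simp add: L_def)
qed

text \<open>
  Let \<open>F z\<close> be the integral of \<open>f (\<phi> u) * \<phi>' u / (\<phi> u - z)\<close> over the circle \<open>norm u = r\<close> with
  \<open>s < r < 1\<close>. For \<open>z = \<phi> v\<close> write \<open>\<phi> u - \<phi> v = (u - v) * \<kappa> u\<close>, where \<open>\<kappa>\<close> is holomorphic and, \<open>\<phi>\<close> being
  injective, has no zeros. Cauchy's formula in the disc gives \<open>F z = 2 * pi * \<i> * f z\<close>, as
  \<open>\<kappa> v = \<phi>' v\<close>. For \<open>z\<close> outside the image of \<open>\<phi>\<close> the integrand is holomorphic in the disc, hence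
  \<open>F z = 0\<close>. So a single Cauchy transform represents both prescribed functions, and by Janiszewski's
  theorem its poles lie in a connected complement.
\<close>

lemma runge_conformal_disc:
  fixes \<phi> :: "complex \<Rightarrow> complex"
  assumes hol: "\<phi> holomorphic_on ball 0 1" and inj: "inj_on \<phi> (ball 0 1)" and s: "s < 1"
    and f: "f holomorphic_on \<phi> ` ball 0 1"
    and T: "compact T" "connected (- T)" "T \<inter> \<phi> ` ball 0 1 = {}" and e: "e > 0"
  obtains p where "\<And>z. z \<in> \<phi> ` cball 0 s \<Longrightarrow> norm (poly p z - f z) < e"
    "\<And>z. z \<in> T \<Longrightarrow> norm (poly p z) < e"
proof -
  define L where "L = \<phi> ` cball 0 s"
  obtain r where r: "s < r" "0 < r" "r < 1" using dense[of "max 0 s" 1] s by auto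
  have sub: "cball 0 s \<subseteq> ball (0::complex) 1" using s by auto
  have contphi: "continuous_on (ball 0 1) \<phi>" by (rule holomorphic_on_imp_continuous_on[OF hol])
  have LG: "L \<subseteq> \<phi> ` ball 0 1" using sub by (auto simp: L_def)
  have cptL: "compact L" and connL: "connected (- L)"
    using conformal_closed_disc[OF hol inj s] by (simp_all add: L_def)
  have "L \<inter> T = {}" using LG T(3) by blast
  then have connS: "connected (- (L \<union> T))"
    by (intro Janiszewski_connected cptL compact_imp_closed T connL) simp
  have cptS: "compact (L \<union> T)" by (intro compact_Un cptL T)
  define c where "c = (\<lambda>u. f (\<phi> u) * deriv \<phi> u)"
  have holc: "c holomorphic_on ball 0 1"
    unfolding c_def
  proof (rule holomorphic_on_mult)
    show "(\<lambda>u. f (\<phi> u)) holomorphic_on ball 0 1"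
      using holomorphic_on_compose_gen[OF hol f] by (simp add: o_def)
    show "deriv \<phi> holomorphic_on ball 0 1" by (rule holomorphic_deriv[OF hol open_ball])
  qed
  define g where "g = circlepath 0 r"
  have g_ball: "g t \<in> ball 0 1" "norm (g t) = r" for t
    using r by (auto simp: g_def circlepath norm_mult)
  have contg: "continuous_on {0..1} g"
    unfolding g_def by (metis path_def path_circlepath)
  define F where "F = (\<lambda>z. contour_integral g (\<lambda>u. c u / (\<phi> u - z)))"
  define c' where "c' = (\<lambda>t::real. c (g t) * (2 * pi * \<i> * r * exp (2 * of_real pi * \<i> * t)))"
  have "poly_approximable (L \<union> T) (\<lambda>z. integral {0..1} (\<lambda>t. c' t / (\<phi> (g t) - z)))"
  proof (rule poly_approximable_cauchy_transform[OF cptS connS])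
    show "continuous_on {0..1} (\<lambda>t. \<phi> (g t))"
      by (rule continuous_on_compose2[OF contphi contg]) (use g_ball in auto)
    show "continuous_on {0..1} c'"
      unfolding c'_def
    proof (rule continuous_on_mult)
      show "continuous_on {0..1} (\<lambda>t. c (g t))"
        by (rule continuous_on_compose2[OF holomorphic_on_imp_continuous_on[OF holc] contg]) (use g_ball in auto)
    qed (intro continuous_intros)
    have "\<phi> (g t) \<notin> L" for t
    proof
      assume "\<phi> (g t) \<in> L"
      then obtain v where v: "norm v \<le> s" "\<phi> (g t) = \<phi> v" by (auto simp: L_def)
      then have "g t = v" using inj_onD[OF inj v(2)] g_ball[of t] s by auto
      then show False using v g_ball[of t] r by simp
    qed
    moreover have "\<phi> (g t) \<notin> T" for t using T(3) g_ball[of t] by blast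
    ultimately show "(\<lambda>t. \<phi> (g t)) ` {0..1} \<inter> (L \<union> T) = {}" by auto
  qed
  moreover have "(\<lambda>z. integral {0..1} (\<lambda>t. c' t / (\<phi> (g t) - z))) = F"
    unfolding F_def contour_integral_integral c'_def g_def vector_derivative_circlepath by simp
  ultimately have FA: "poly_approximable (L \<union> T) F" by simp
  have FL: "F z = 2 * pi * \<i> * f z" if zL: "z \<in> L" for z
  proof -
    obtain v where v: "norm v \<le> s" "z = \<phi> v" using zL by (auto simp: L_def)
    then have vb: "v \<in> ball 0 1" using s by auto
    define \<kappa> where "\<kappa> = (\<lambda>u. if u = v then deriv \<phi> v else (\<phi> u - \<phi> v) / (u - v))"
    have hk: "\<kappa> holomorphic_on ball 0 1" unfolding \<kappa>_def by (rule pole_lemma_open[OF hol]) simp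
    have dv: "deriv \<phi> v \<noteq> 0" by (rule holomorphic_injective_imp_regular[OF hol _ inj vb]) simp
    have k0: "\<kappa> u \<noteq> 0" if "u \<in> ball 0 1" for u
      using dv inj_onD[OF inj _ that vb] by (auto simp: \<kappa>_def)
    have hq: "(\<lambda>u. c u / \<kappa> u) holomorphic_on cball 0 r"
      by (rule holomorphic_on_divide[OF holomorphic_on_subset[OF holc] holomorphic_on_subset[OF hk]]) (use r k0 in auto)
    have "((\<lambda>u. c u / \<kappa> u / (u - v)) has_contour_integral (2 * of_real pi * \<i> * (c v / \<kappa> v))) g"
      unfolding g_def by (rule Cauchy_integral_circlepath_simple[OF hq]) (use v r in simp)
    then have "((\<lambda>u. c u / (\<phi> u - z)) has_contour_integral (2 * of_real pi * \<i> * (c v / \<kappa> v))) g"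
    proof (rule has_contour_integral_eq)
      fix u assume "u \<in> path_image g"
      then have "u \<noteq> v" using v r by (auto simp: g_def path_image_circlepath)
      then show "c u / \<kappa> u / (u - v) = c u / (\<phi> u - z)" by (simp add: \<kappa>_def v)
    qed
    then have "F z = 2 * of_real pi * \<i> * (c v / \<kappa> v)"
      unfolding F_def by (rule contour_integral_unique)
    moreover have "c v / \<kappa> v = f z" using dv by (simp add: c_def \<kappa>_def v)
    ultimately show ?thesis by simp
  qed
  have FT: "F z = 0" if "z \<in> T" for z
  proof -
    have "(\<lambda>u. c u / (\<phi> u - z)) holomorphic_on ball 0 1"
      by (rule holomorphic_on_divide[OF holc holomorphic_on_diff[OF hol holomorphic_on_const]]) (use T(3) that in auto)
    then have "((\<lambda>u. c u / (\<phi> u - z)) has_contour_integral 0) g"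
      by (rule Cauchy_theorem_convex_simple) (use r in \<open>auto simp: g_def path_image_circlepath\<close>)
    then show ?thesis unfolding F_def by (rule contour_integral_unique)
  qed
  have "poly_approximable (L \<union> T) (\<lambda>z. 1 / (2 * pi * \<i>) * F z)"
    by (intro poly_approximable_mult cptS poly_approximable_const FA)
  then obtain p where p: "\<And>z. z \<in> L \<union> T \<Longrightarrow> norm (poly p z - 1 / (2 * pi * \<i>) * F z) < e"
    using e by (rule poly_approximableD) auto
  show ?thesis
  proof (rule that)
    show "norm (poly p z - f z) < e" if "z \<in> \<phi> ` cball 0 s" for z
      using p[of z] FL[of z] that by (simp add: L_def)
    show "norm (poly p z) < e" if "z \<in> T" for z
      using p[of z] FT[OF that] that by simp
  qed
qed

text \<open>
  The set \<open>L\<close> is chosen before \<open>f\<close> and \<open>T\<close>, since the sets on which smallness is required later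
  depend on \<open>L\<close> itself.
\<close>

lemma runge_simply_connected:
  assumes G: "open G" "simply_connected G" "G \<noteq> {}" "G \<noteq> UNIV" and K: "compact K" "K \<subseteq> G"
  obtains L where "compact L" "K \<subseteq> L" "L \<subseteq> G" "connected (- L)"
    "\<And>f T e. \<lbrakk>f holomorphic_on G; compact T; connected (- T); T \<inter> G = {}; e > 0\<rbrakk>
       \<Longrightarrow> \<exists>p. (\<forall>z\<in>L. norm (poly p z - f z) < e) \<and> (\<forall>z\<in>T. norm (poly p z) < e)"
proof -
  obtain \<psi> \<phi> where \<psi>: "\<psi> holomorphic_on G" and \<phi>: "\<phi> holomorphic_on ball 0 1"
    and left: "\<And>z. z \<in> G \<Longrightarrow> \<psi> z \<in> ball 0 1 \<and> \<phi> (\<psi> z) = z"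
    and right: "\<And>z. z \<in> ball 0 1 \<Longrightarrow> \<phi> z \<in> G \<and> \<psi> (\<phi> z) = z"
    using simply_connected_eq_biholomorphic_to_disc[OF G(1)] G(2-4) by metis
  have img: "\<phi> ` ball 0 1 = G"
  proof
    show "\<phi> ` ball 0 1 \<subseteq> G" using right by blast
    show "G \<subseteq> \<phi> ` ball 0 1"
    proof
      fix z assume "z \<in> G"
      then show "z \<in> \<phi> ` ball 0 1" using left[of z] by (intro image_eqI[of _ _ "\<psi> z"]) auto
    qed
  qed
  have inj: "inj_on \<phi> (ball 0 1)" using right by (metis inj_onI)
  have "compact (\<psi> ` K)"
    by (rule compact_continuous_image[OF continuous_on_subset[OF holomorphic_on_imp_continuous_on[OF \<psi>] K(2)] K(1)])
  moreover have "\<psi> ` K \<subseteq> ball 0 1" using left K(2) by blast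
  ultimately obtain \<epsilon> where \<epsilon>: "\<epsilon> > 0" "(\<Union>x\<in>\<psi> ` K. cball x \<epsilon>) \<subseteq> ball 0 1"
    using compact_subset_open_imp_cball_epsilon_subset[OF _ open_ball] by metis
  define s where "s = 1 - \<epsilon>"
  have s: "s < 1" using \<epsilon>(1) by (simp add: s_def)
  have KL: "K \<subseteq> \<phi> ` cball 0 s"
  proof
    fix z assume z: "z \<in> K"
    then have "cball (\<psi> z) \<epsilon> \<subseteq> ball 0 1" using \<epsilon>(2) by blast
    then have "\<psi> z \<in> cball 0 s" using \<epsilon>(1) by (simp add: cball_subset_ball_iff s_def)
    then show "z \<in> \<phi> ` cball 0 s" using left[of z] z K(2) by (metis image_eqI subsetD)
  qed
  show ?thesis
  proof (rule that[OF conformal_closed_disc(1)[OF \<phi> inj s] KL _ conformal_closed_disc(2)[OF \<phi> inj s]])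
    show "\<phi> ` cball 0 s \<subseteq> G" using img s by auto
    fix f :: "complex \<Rightarrow> complex" and T :: "complex set" and e :: real
    assume f: "f holomorphic_on G" and T: "compact T" "connected (- T)" "T \<inter> G = {}" and e: "e > 0"
    show "\<exists>p. (\<forall>z\<in>\<phi> ` cball 0 s. norm (poly p z - f z) < e) \<and> (\<forall>z\<in>T. norm (poly p z) < e)"
      by (rule runge_conformal_disc[OF \<phi> inj s f[folded img] T(1,2) T(3)[folded img] e]) blast
  qed
qed

section \<open>Polynomials that jump from 0 to 1 at a geometric rate\<close>

text \<open>
  The upper half of the binomial expansion of \<open>(u + (1 - u)) ^ (2 * m) = 1\<close>: the probability of at least
  \<open>m\<close> successes in \<open>2 * m\<close> trials with success probability \<open>u\<close>. Its zero at \<open>u = 0\<close> has order \<open>m\<close> and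
  \<open>1 - step_poly m u\<close> vanishes at \<open>u = 1\<close> to order \<open>m + 1\<close>, so near these two values the errors decay
  geometrically in \<open>m\<close>, while the degree grows only linearly.
\<close>

definition step_poly :: "nat \<Rightarrow> 'a::comm_ring_1 poly \<Rightarrow> 'a poly" where
  "step_poly m u = (\<Sum>k=m..2*m. of_nat ((2*m) choose k) * (u ^ k * (1 - u) ^ (2*m - k)))"

lemma degree_step_poly_le:
  fixes u :: "'a::comm_ring_1 poly"
  shows "degree (step_poly m u) \<le> 2 * m * degree u"
  unfolding step_poly_def
proof (rule degree_sum_le)
  fix k assume k: "k \<in> {m..2*m}"
  have "degree (1 - u) \<le> degree u"
    using degree_diff_le_max[of 1 u] by simp
  then have "degree (u ^ k * (1 - u) ^ (2*m - k)) \<le> degree u * k + degree u * (2*m - k)"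
    by (intro order_trans[OF degree_mult_le] add_mono order_trans[OF degree_power_le] mult_right_mono) simp_all
  also have "\<dots> = 2 * m * degree u"
    using k by (simp flip: distrib_left)
  finally show "degree (of_nat ((2*m) choose k) * (u ^ k * (1 - u) ^ (2*m - k))) \<le> 2 * m * degree u"
    by (simp add: of_nat_poly order_trans[OF degree_smult_le])
qed simp

text \<open>
  Every term carries at least \<open>m\<close> factors \<open>x\<close> and at most \<open>m\<close> factors \<open>y\<close>, and the binomial
  coefficients sum to \<open>4 ^ m\<close>; altogether \<open>(4 * 2 / 16) ^ m\<close>. The summation range is left open
  so that the bound also serves the complementary half with \<open>x\<close> and \<open>y\<close> exchanged.
\<close>

lemma binomial_upper_half_bound:
  fixes x y :: complex
  assumes "norm x \<le> 1/16" "norm y \<le> 2" "K \<subseteq> {m..2*m}"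
  shows "norm (\<Sum>k\<in>K. of_nat ((2*m) choose k) * (x ^ k * y ^ (2*m - k))) \<le> (1/2) ^ m"
proof -
  have term_le: "norm (of_nat ((2*m) choose k) * (x ^ k * y ^ (2*m - k))) \<le> real ((2*m) choose k) * (1/8) ^ m"
    if "k \<in> K" for k
  proof -
    have "k \<in> {m..2*m}" using that assms(3) by blast
    then have k: "m \<le> k" "2*m - k \<le> m" by auto
    have "norm x ^ k \<le> norm x ^ m" using k assms(1) by (intro power_decreasing) auto
    also have "\<dots> \<le> (1/16) ^ m" using assms(1) by (intro power_mono) auto
    finally have 1: "norm x ^ k \<le> (1/16) ^ m" .
    have "norm y ^ (2*m - k) \<le> 2 ^ (2*m - k)" using assms(2) by (intro power_mono) auto
    also have "\<dots> \<le> 2 ^ m" using k by (intro power_increasing) auto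
    finally have 2: "norm y ^ (2*m - k) \<le> 2 ^ m" .
    have "norm x ^ k * norm y ^ (2*m - k) \<le> (1/16) ^ m * 2 ^ m"
      by (intro mult_mono 1 2) auto
    also have "\<dots> = (1/8) ^ m" by (simp flip: power_mult_distrib)
    finally show ?thesis by (simp add: norm_mult norm_power mult_left_mono)
  qed
  have "norm (\<Sum>k\<in>K. of_nat ((2*m) choose k) * (x ^ k * y ^ (2*m - k))) \<le> (\<Sum>k\<in>K. real ((2*m) choose k) * (1/8) ^ m)"
    by (intro order_trans[OF norm_sum] sum_mono term_le)
  also have "\<dots> \<le> (\<Sum>k\<le>2*m. real ((2*m) choose k) * (1/8) ^ m)"
    using assms(3) by (intro sum_mono2) auto
  also have "\<dots> = real (\<Sum>k\<le>2*m. (2*m) choose k) * (1/8) ^ m"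
    by (simp add: sum_distrib_right)
  also have "\<dots> = 4 ^ m * (1/8) ^ m"
    by (simp add: choose_row_sum power_mult)
  also have "\<dots> = (1/2) ^ m"
    by (simp flip: power_mult_distrib)
  finally show ?thesis .
qed

lemma poly_step_poly:
  "poly (step_poly m u) z = (\<Sum>k=m..2*m. of_nat ((2*m) choose k) * (poly u z ^ k * (1 - poly u z) ^ (2*m - k)))"
  by (simp add: step_poly_def poly_sum)

lemma norm_step_poly_near_0:
  assumes "norm (poly u z :: complex) \<le> 1/16"
  shows "norm (poly (step_poly m u) z) \<le> (1/2) ^ m"
proof -
  have "norm (1 - poly u z) \<le> 2" using norm_triangle_ineq4[of 1 "poly u z"] assms by simp
  then show ?thesis unfolding poly_step_poly by (rule binomial_upper_half_bound[OF assms]) simp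
qed

lemma norm_step_poly_near_1:
  assumes "norm (poly u z - 1 :: complex) \<le> 1/16"
  shows "norm (poly (step_poly m u) z - 1) \<le> (1/2) ^ m"
proof -
  define x where "x = poly u z"
  define y where "y = 1 - x"
  have y: "norm y \<le> 1/16" using assms by (simp add: x_def y_def norm_minus_commute)
  have x: "norm x \<le> 2" using norm_triangle_ineq4[of 1 y] y by (simp add: y_def)
  have "1 = (\<Sum>k\<le>2*m. of_nat ((2*m) choose k) * (x ^ k * y ^ (2*m - k)))"
    using binomial_ring[of x y "2*m"] by (simp add: y_def mult.assoc)
  \<comment> \<open>The lower half of the expansion is an upper half once the roles of \<open>x\<close> and \<open>y\<close> are exchanged.\<close>
  also have "{..2*m} = {..<m} \<union> {m..2*m}" by auto
  also have "(\<Sum>k\<in>{..<m} \<union> {m..2*m}. of_nat ((2*m) choose k) * (x ^ k * y ^ (2*m - k))) =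
     (\<Sum>k<m. of_nat ((2*m) choose k) * (x ^ k * y ^ (2*m - k))) + poly (step_poly m u) z"
    by (subst sum.union_disjoint) (auto simp: poly_step_poly x_def y_def)
  finally have "1 - poly (step_poly m u) z = (\<Sum>k<m. of_nat ((2*m) choose k) * (x ^ k * y ^ (2*m - k)))"
    by (simp add: algebra_simps)
  also have "\<dots> = (\<Sum>k=m+1..2*m. of_nat ((2*m) choose k) * (y ^ k * x ^ (2*m - k)))"
  proof (rule sum.reindex_bij_witness[of _ "\<lambda>k. 2*m - k" "\<lambda>k. 2*m - k"])
    fix k assume "k \<in> {..<m}"
    then have "k \<le> 2*m" "2*m - (2*m - k) = k" by auto
    then show "of_nat ((2*m) choose (2*m - k)) * (y ^ (2*m - k) * x ^ (2*m - (2*m - k))) =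
        of_nat ((2*m) choose k) * (x ^ k * y ^ (2*m - k))"
      using binomial_symmetric[of k "2*m"] by (simp add: mult.commute)
  qed auto
  finally have "norm (1 - poly (step_poly m u) z) \<le> (1/2) ^ m"
    using binomial_upper_half_bound[OF y x, of "{m+1..2*m}" m] by simp
  then show ?thesis by (simp add: norm_minus_commute)
qed

section \<open>The space of holomorphic functions as a Baire space\<close>

lemma restrict_in_hol_funs: "f holomorphic_on G \<Longrightarrow> restrict f G \<in> hol_funs G"
  unfolding hol_funs_def by (auto intro: holomorphic_transform)

lemma hol_funs_holomorphic: "f \<in> hol_funs G \<Longrightarrow> f holomorphic_on G"
  by (simp add: hol_funs_def)

lemma hol_openD:
  assumes "hol_open G U" "f \<in> U"
  obtains K e where "compact K" "K \<subseteq> G" "e > 0"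
    "\<And>g. g \<in> hol_funs G \<Longrightarrow> (\<And>z. z \<in> K \<Longrightarrow> norm (g z - f z) < e) \<Longrightarrow> g \<in> U"
proof -
  obtain K e where K: "compact K" "K \<subseteq> G" "e > 0" "{g \<in> hol_funs G. \<forall>z\<in>K. dist (g z) (f z) < e} \<subseteq> U"
    using assms unfolding hol_open_def by meson
  show ?thesis
    by (rule that[OF K(1-3)]) (use K(4) in \<open>auto simp: dist_norm\<close>)
qed

text \<open>
  On a compact set the supremum of \<open>norm (g z - p z)\<close> is attained, which leaves room for a whole
  neighbourhood of \<open>g\<close>.
\<close>

lemma hol_open_uniform_neighbourhood:
  assumes K: "compact K" "K \<subseteq> G" and p: "continuous_on G p"
  shows "hol_open G {g \<in> hol_funs G. \<forall>z\<in>K. norm (g z - p z) < e}"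
  unfolding hol_open_def
proof (intro conjI ballI)
  fix g assume "g \<in> {g \<in> hol_funs G. \<forall>z\<in>K. norm (g z - p z) < e}"
  then have g: "g \<in> hol_funs G" "\<And>z. z \<in> K \<Longrightarrow> norm (g z - p z) < e" by auto
  show "\<exists>K' d. compact K' \<and> K' \<subseteq> G \<and> d > 0 \<and>
     {h \<in> hol_funs G. \<forall>z\<in>K'. dist (h z) (g z) < d} \<subseteq> {g \<in> hol_funs G. \<forall>z\<in>K. norm (g z - p z) < e}"
  proof (cases "K = {}")
    case True
    then show ?thesis by (intro exI[of _ "{}"] exI[of _ 1]) auto
  next
    case False
    have "continuous_on K (\<lambda>z. norm (g z - p z))"
      using holomorphic_on_imp_continuous_on[OF hol_funs_holomorphic[OF g(1)]] p
      by (intro continuous_on_norm continuous_on_diff) (auto intro: continuous_on_subset[OF _ K(2)])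
    then obtain z0 where z0: "z0 \<in> K" "\<And>z. z \<in> K \<Longrightarrow> norm (g z - p z) \<le> norm (g z0 - p z0)"
      using continuous_attains_sup[OF K(1) False] by blast
    define d where "d = e - norm (g z0 - p z0)"
    have "d > 0" using g(2)[OF z0(1)] by (simp add: d_def)
    moreover have "norm (h z - p z) < e" if "\<forall>z\<in>K. dist (h z) (g z) < d" "z \<in> K" for h z
    proof -
      have "norm (h z - g z) < d" using that by (simp add: dist_norm)
      then have "norm ((h z - g z) + (g z - p z)) < e"
        by (intro norm_triangle_lt) (use z0(2)[OF that(2)] in \<open>simp add: d_def\<close>)
      then show ?thesis by simp
    qed
    ultimately show ?thesis using K by (intro exI[of _ K] exI[of _ d]) blast
  qed
qed blast

text \<open>
  Baire's theorem for \<open>H(G)\<close>, by nested closed neighbourhoods \<open>N f K e\<close>. The compact sets \<open>K\<close> grow along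
  an exhaustion of \<open>G\<close> and the radii \<open>e\<close> are at least halved, so the centres converge locally uniformly;
  the limit is holomorphic and belongs to all the neighbourhoods.
\<close>

lemma baire_hol_open:
  assumes G: "open G" and V: "\<And>k::nat. hol_open G (V k)"
    and dense: "\<And>k f K e. \<lbrakk>f \<in> hol_funs G; compact K; K \<subseteq> G; e > 0\<rbrakk>
        \<Longrightarrow> \<exists>g\<in>V k. \<forall>z\<in>K. norm (g z - f z) < e"
  shows "\<exists>f\<in>hol_funs G. \<forall>k. f \<in> V k"
proof -
  obtain C where C: "\<And>n::nat. compact (C n)" "\<And>n. C n \<subseteq> G"
    "\<And>K. compact K \<Longrightarrow> K \<subseteq> G \<Longrightarrow> \<exists>N. \<forall>n\<ge>N. K \<subseteq> C n"
    using open_Union_compact_subsets[OF G] by metis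
  define N where "N = (\<lambda>f K (e::real). {g \<in> hol_funs G. \<forall>z\<in>K. norm (g z - f z) \<le> e})"
  define P where "P = (\<lambda>n (f, K, e). f \<in> hol_funs G \<and> compact K \<and> K \<subseteq> G \<and> C n \<subseteq> K \<and>
     0 < e \<and> e \<le> (1/2) ^ n \<and> N f K e \<subseteq> V n)"
  define R where "R = (\<lambda>(f :: complex \<Rightarrow> complex, K :: complex set, e) (f' :: complex \<Rightarrow> complex, K', e'). K \<subseteq> K' \<and> e' \<le> e / 2 \<and> (\<forall>z\<in>K. norm (f' z - f z) \<le> e / (2::real)))"
  have step: "\<exists>y. P n y \<and> R (f, K, e) y"
    if f: "f \<in> hol_funs G" "compact K" "K \<subseteq> G" "e > 0" for n f K and e :: real
  proof -
    have e2: "e / 2 > 0" using f(4) by simp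
    obtain g where g: "g \<in> V n" "\<And>z. z \<in> K \<Longrightarrow> norm (g z - f z) < e / 2"
      using dense[OF f(1-3) e2, of n] by blast
    obtain L d where L: "compact L" "L \<subseteq> G" "d > 0"
      "\<And>h. h \<in> hol_funs G \<Longrightarrow> (\<And>z. z \<in> L \<Longrightarrow> norm (h z - g z) < d) \<Longrightarrow> h \<in> V n"
      by (rule hol_openD[OF V g(1)]) auto
    define K' where "K' = K \<union> L \<union> C n"
    define e' where "e' = min (d / 2) (min (e / 2) ((1/2) ^ n))"
    have "N g K' e' \<subseteq> V n"
    proof
      fix h assume h: "h \<in> N g K' e'"
      show "h \<in> V n"
      proof (rule L(4))
        show "h \<in> hol_funs G" using h by (simp add: N_def)
        fix z assume "z \<in> L"
        then have "norm (h z - g z) \<le> d / 2" using h by (auto simp: N_def K'_def e'_def)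
        then show "norm (h z - g z) < d" using L(3) by linarith
      qed
    qed
    moreover have "g \<in> hol_funs G" using g(1) V unfolding hol_open_def by blast
    moreover have "compact K'" "K' \<subseteq> G" using f L C by (auto simp: K'_def)
    moreover have "e' > 0" "e' \<le> e / 2" "e' \<le> (1/2) ^ n" using L(3) f(4) by (auto simp: e'_def)
    moreover have "K \<subseteq> K'" "C n \<subseteq> K'" by (auto simp: K'_def)
    moreover have "\<forall>z\<in>K. norm (g z - f z) \<le> e / 2" using g(2) less_imp_le by blast
    ultimately have "P n (g, K', e') \<and> R (f, K, e) (g, K', e')"
      unfolding P_def R_def by simp
    then show ?thesis by blast
  qed
  have "\<exists>x. \<forall>n. P n (x n) \<and> R (x n) (x (Suc n))"
  proof (rule dependent_nat_choice)
    have "restrict (\<lambda>_. 0) G \<in> hol_funs G"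
      by (rule restrict_in_hol_funs) simp
    then show "\<exists>y. P 0 y" using step[of "restrict (\<lambda>_. 0) G" "{}" 1 0] by auto
    show "\<exists>y. P (Suc n) y \<and> R x y" if "P n x" for x n
    proof (cases x)
      case (fields f K e)
      then show ?thesis using step[of f K e "Suc n"] that unfolding P_def by simp
    qed
  qed
  then obtain x where x: "\<And>n. P n (x n)" "\<And>n. R (x n) (x (Suc n))" by auto
  define f where "f = (\<lambda>n. fst (x n))"
  define K where "K = (\<lambda>n. fst (snd (x n)))"
  define e where "e = (\<lambda>n. snd (snd (x n)))"
  have xeq: "x n = (f n, K n, e n)" for n by (simp add: f_def K_def e_def)
  have f: "f n \<in> hol_funs G" and K: "compact (K n)" "K n \<subseteq> G" "C n \<subseteq> K n"
    and e: "0 < e n" "e n \<le> (1/2) ^ n" and NV: "N (f n) (K n) (e n) \<subseteq> V n" for n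
    using x(1)[of n] unfolding xeq P_def by auto
  have Kmono: "K n \<subseteq> K (Suc n)" and ehalf: "e (Suc n) \<le> e n / 2"
    and near: "\<And>z. z \<in> K n \<Longrightarrow> norm (f (Suc n) z - f n z) \<le> e n / 2" for n
    using x(2)[of n] unfolding xeq R_def by auto
  have Kmono': "K n \<subseteq> K m" if "n \<le> m" for n m
    using that Kmono by (rule lift_Suc_mono_le[of K, rotated])
  \<comment> \<open>Each step moves the centre by at most \<open>e m / 2 \<le> e m - e (Suc m)\<close>, so the moves telescope.\<close>
  have close: "norm (f m z - f n z) \<le> e n - e m" if "n \<le> m" "z \<in> K n" for n m z
    using that(1)
  proof (induction m rule: dec_induct)
    case (step m)
    have "z \<in> K m" using Kmono'[OF step.hyps(1)] that(2) by blast
    then have "norm (f (Suc m) z - f m z) \<le> e m / 2" by (rule near)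
    moreover have "norm (f (Suc m) z - f n z) \<le> norm (f (Suc m) z - f m z) + norm (f m z - f n z)"
      using norm_triangle_ineq[of "f (Suc m) z - f m z" "f m z - f n z"] by simp
    ultimately show ?case using step.IH ehalf[of m] by linarith
  qed simp
  have e0: "e \<longlonglongrightarrow> 0"
  proof (rule tendsto_sandwich[of "\<lambda>_. 0" e sequentially "\<lambda>n. (1/2) ^ n"])
    show "(\<lambda>n. (1/2::real) ^ n) \<longlonglongrightarrow> 0" by (rule LIMSEQ_power_zero) simp
    show "\<forall>\<^sub>F n in sequentially. 0 \<le> e n" "\<forall>\<^sub>F n in sequentially. e n \<le> (1/2) ^ n"
      by (simp_all add: e less_imp_le always_eventually)
  qed simp
  have conv: "convergent (\<lambda>m. f m z)" if z: "z \<in> K n" for z n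
  proof (rule Cauchy_convergent, rule metric_CauchyI)
    fix r :: real assume "r > 0"
    then obtain M where M: "\<And>m. m \<ge> M \<Longrightarrow> e m < r / 2"
      using order_tendstoD(2)[OF e0, of "r/2"] unfolding eventually_sequentially by auto
    define M' where "M' = max M n"
    have zM: "z \<in> K M'" using Kmono'[of n M'] z by (auto simp: M'_def)
    have "dist (f m z) (f M' z) < r / 2" if "m \<ge> M'" for m
      using close[OF that zM] M[of M'] e(1)[of m] by (simp add: dist_norm M'_def)
    then show "\<exists>M. \<forall>m\<ge>M. \<forall>n\<ge>M. dist (f m z) (f n z) < r"
      by (intro exI[of _ M'] allI impI dist_triangle_half_l[of _ "f M' z" r]) auto
  qed
  define F where "F = restrict (\<lambda>z. lim (\<lambda>m. f m z)) G"
  have Flim: "norm (F z - f m z) \<le> e m" if "z \<in> K m" for z m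
  proof -
    have "(\<lambda>i. f i z) \<longlonglongrightarrow> F z"
      using conv[OF that] K(2)[of m] that by (auto simp: F_def convergent_LIMSEQ_iff)
    then have "(\<lambda>i. norm (f i z - f m z)) \<longlonglongrightarrow> norm (F z - f m z)"
      by (intro tendsto_norm tendsto_diff tendsto_const)
    moreover have "norm (f i z - f m z) \<le> e m" if "i \<ge> m" for i
      using close[OF that \<open>z \<in> K m\<close>] e(1)[of i] by linarith
    then have "\<exists>N. \<forall>i\<ge>N. norm (f i z - f m z) \<le> e m" by blast
    ultimately show ?thesis by (rule LIMSEQ_le_const2)
  qed
  have ulim: "uniform_limit (C n) f F sequentially" for n
  proof (rule uniform_limitI)
    fix r :: real assume "r > 0"
    then have "\<forall>\<^sub>F m in sequentially. e m < r" using order_tendstoD(2)[OF e0] by blast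
    then show "\<forall>\<^sub>F m in sequentially. \<forall>z\<in>C n. dist (f m z) (F z) < r"
      using eventually_ge_at_top[of n]
    proof eventually_elim
      case (elim m)
      show ?case
      proof
        fix z assume "z \<in> C n"
        then have "z \<in> K m" using K(3)[of n] Kmono'[OF elim(2)] by blast
        then show "dist (f m z) (F z) < r" using Flim[of z m] elim(1) by (simp add: dist_norm norm_minus_commute)
      qed
    qed
  qed
  have "F holomorphic_on G"
  proof (rule holomorphic_uniform_sequence[OF G])
    show "f n holomorphic_on G" for n using f by (rule hol_funs_holomorphic)
    fix z assume "z \<in> G"
    then obtain d where d: "d > 0" "cball z d \<subseteq> G" using G open_contains_cball by blast
    then obtain n where "cball z d \<subseteq> C n" using C(3)[OF compact_cball d(2)] by blast
    then have "uniform_limit (cball z d) f F sequentially" by (rule uniform_limit_on_subset[OF ulim])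
    then show "\<exists>d>0. cball z d \<subseteq> G \<and> uniform_limit (cball z d) f F sequentially" using d by blast
  qed
  then have F: "F \<in> hol_funs G" by (simp add: hol_funs_def F_def)
  have "F \<in> V k" for k
    using NV[of k] F Flim[of _ k] unfolding N_def by blast
  then show ?thesis using F by blast
qed

section \<open>Taylor sums as operators\<close>

lemma higher_deriv_poly:
  "(deriv ^^ j) (poly p) = poly ((pderiv ^^ j) p)" for p :: "complex poly"
proof (induction j)
  case (Suc j)
  have "deriv (poly q) = poly (pderiv q)" for q :: "complex poly"
    by (rule ext) (rule DERIV_imp_deriv[OF poly_DERIV])
  then show ?case using Suc by simp
qed simp

text \<open>
  A Taylor series of a polynomial of degree at most \<open>n\<close> breaks off after the term of order \<open>n\<close>, and its
  sum at \<open>\<zeta> + a * \<zeta>\<close> is the value of the polynomial there.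
\<close>

lemma taylor_op_poly:
  assumes "degree p \<le> n" "\<zeta> \<in> G"
  shows "taylor_op G a n (poly p) \<zeta> = poly p ((a + 1) * \<zeta>)"
proof -
  let ?t = "\<lambda>j. (deriv ^^ j) (poly p) \<zeta> / fact j * (a * \<zeta>) ^ j"
  have "poly p holomorphic_on ball \<zeta> (norm (a * \<zeta>) + 1)"
    by (rule poly_holomorphic_on[OF holomorphic_on_ident])
  then have "(\<lambda>j. (deriv ^^ j) (poly p) \<zeta> / fact j * ((a + 1) * \<zeta> - \<zeta>) ^ j) sums poly p ((a + 1) * \<zeta>)"
    by (rule holomorphic_power_series) (simp add: dist_norm algebra_simps norm_minus_commute)
  then have "?t sums poly p ((a + 1) * \<zeta>)" by (simp add: algebra_simps)
  moreover have "?t sums (\<Sum>j\<in>{0..n}. ?t j)"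
  proof (rule sums_finite)
    fix j assume "j \<notin> {0..n}"
    then have "degree p < j" using assms(1) by simp
    have "degree ((pderiv ^^ (degree p)) p) = 0" by (simp add: degree_higher_pderiv)
    then have "pderiv ((pderiv ^^ (degree p)) p) = 0" by (simp add: pderiv_eq_0_iff)
    moreover have "j = (j - Suc (degree p)) + Suc (degree p)" using \<open>degree p < j\<close> by simp
    ultimately have "(pderiv ^^ j) p = 0"
      by (metis comp_apply funpow.simps(2) funpow_add higher_pderiv_0)
    then show "?t j = 0" by (simp add: higher_deriv_poly)
  qed simp
  ultimately have "poly p ((a + 1) * \<zeta>) = (\<Sum>j\<in>{0..n}. ?t j)"
    by (rule sums_unique2)
  then show ?thesis using assms(2) by (simp add: taylor_op_def)
qed

lemma taylor_op_cong:
  assumes "open G" "f holomorphic_on G" "g holomorphic_on G" "\<And>z. z \<in> G \<Longrightarrow> f z = g z"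
  shows "taylor_op G a n f = taylor_op G a n g"
  unfolding taylor_op_def
  using higher_deriv_transform_within_open[OF assms(2,3,1)] assms(4)
  by (intro restrict_ext sum.cong refl) simp

lemma taylor_op_add:
  assumes "open G" "f holomorphic_on G" "g holomorphic_on G" "\<zeta> \<in> G"
  shows "taylor_op G a n (\<lambda>z. f z + g z) \<zeta> = taylor_op G a n f \<zeta> + taylor_op G a n g \<zeta>"
  using assms by (simp add: taylor_op_def higher_deriv_add[OF assms(2,3,1)] add_divide_distrib distrib_right sum.distrib)

lemma taylor_op_cmult:
  assumes "open G" "f holomorphic_on G" "\<zeta> \<in> G"
  shows "taylor_op G a n (\<lambda>z. c * f z) \<zeta> = c * taylor_op G a n f \<zeta>"
  using assms by (simp add: taylor_op_def higher_deriv_cmult[of f G \<zeta>] sum_distrib_left mult.assoc)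

lemma taylor_op_diff:
  assumes "open G" "f holomorphic_on G" "g holomorphic_on G" "\<zeta> \<in> G"
  shows "taylor_op G a n (\<lambda>z. f z - g z) \<zeta> = taylor_op G a n f \<zeta> - taylor_op G a n g \<zeta>"
  using assms by (simp add: taylor_op_def higher_deriv_diff[OF assms(2,3,1)] diff_divide_distrib left_diff_distrib sum_subtractf)

lemma taylor_op_sum:
  assumes "open G" "finite I" "\<And>i. i \<in> I \<Longrightarrow> f i holomorphic_on G" "\<zeta> \<in> G"
  shows "taylor_op G a n (\<lambda>z. \<Sum>i\<in>I. f i z) \<zeta> = (\<Sum>i\<in>I. taylor_op G a n (f i) \<zeta>)"
  using assms(2,3)
proof (induction I rule: finite_induct)
  case empty
  show ?case using taylor_op_cmult[OF assms(1) holomorphic_on_const assms(4), of a n 0 0] by simp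
next
  case (insert i I)
  have "(\<lambda>z. \<Sum>i\<in>I. f i z) holomorphic_on G"
    by (rule holomorphic_on_sum, rule insert.prems) simp
  moreover have "f i holomorphic_on G" by (rule insert.prems) simp
  ultimately have "taylor_op G a n (\<lambda>z. f i z + (\<Sum>i\<in>I. f i z)) \<zeta> =
      taylor_op G a n (f i) \<zeta> + taylor_op G a n (\<lambda>z. \<Sum>i\<in>I. f i z) \<zeta>"
    by (intro taylor_op_add assms(1,4))
  moreover have "taylor_op G a n (\<lambda>z. \<Sum>i\<in>I. f i z) \<zeta> = (\<Sum>i\<in>I. taylor_op G a n (f i) \<zeta>)"
    by (rule insert.IH, rule insert.prems) simp
  ultimately show ?case using insert.hyps by simp
qed

lemma holomorphic_taylor_op:
  assumes "open G" "f holomorphic_on G"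
  shows "taylor_op G a n f holomorphic_on G"
proof -
  have "(\<lambda>\<zeta>. \<Sum>j=0..n. (deriv ^^ j) f \<zeta> / fact j * (a * \<zeta>) ^ j) holomorphic_on G"
    by (intro holomorphic_on_sum holomorphic_on_mult holomorphic_on_divide holomorphic_on_power
         holomorphic_higher_deriv holomorphic_on_const holomorphic_on_ident assms) simp
  then show ?thesis
    by (rule holomorphic_transform) (simp add: taylor_op_def)
qed

text \<open>
  Cauchy's inequalities on discs of a fixed radius \<open>r\<close> about the points of \<open>K\<close>; \<open>K'\<close> is the union of
  these discs. Neither \<open>K'\<close> nor \<open>B\<close> depends on \<open>n\<close> or \<open>f\<close>: for fixed \<open>n\<close> the estimate gives continuity
  of the operator, and its merely exponential growth in \<open>n\<close> is what the step polynomials can beat.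
\<close>

lemma taylor_op_bound:
  assumes "open G" "compact K" "K \<subseteq> G"
  obtains K' B where "compact K'" "K' \<subseteq> G" "B \<ge> 1"
    "\<And>f n Q \<zeta>. \<lbrakk>f holomorphic_on G; \<And>z. z \<in> K' \<Longrightarrow> norm (f z) \<le> Q; \<zeta> \<in> K\<rbrakk>
       \<Longrightarrow> norm (taylor_op G a n f \<zeta>) \<le> (real n + 1) * Q * B ^ n"
proof -
  obtain r where r: "r > 0" "(\<Union>x\<in>K. cball x r) \<subseteq> G"
    by (rule compact_subset_open_imp_cball_epsilon_subset[OF assms(2,1,3)])
  obtain R where R: "\<And>z. z \<in> K \<Longrightarrow> norm z \<le> R"
    using compact_imp_bounded[OF assms(2)] unfolding bounded_iff by auto
  define K' where "K' = {x + y | x y. x \<in> K \<and> y \<in> cball 0 r}"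
  have K'_cball: "cball x r \<subseteq> K'" if "x \<in> K" for x
  proof
    fix z assume "z \<in> cball x r"
    then have "z = x + (z - x)" "z - x \<in> cball 0 r" by (auto simp: dist_norm norm_minus_commute)
    then show "z \<in> K'" unfolding K'_def using that by blast
  qed
  have K'G: "K' \<subseteq> G"
  proof
    fix z assume "z \<in> K'"
    then obtain x y where xy: "x \<in> K" "norm y \<le> r" "z = x + y" by (auto simp: K'_def)
    then have "z \<in> cball x r" by (simp add: dist_norm)
    then show "z \<in> G" using r(2) xy(1) by blast
  qed
  define B where "B = max 1 (norm a * R / r)"
  show ?thesis
  proof (rule that[of K' B])
    show "compact K'" unfolding K'_def by (intro compact_sums assms compact_cball)
    show "K' \<subseteq> G" by fact
    show "B \<ge> 1" by (simp add: B_def)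
    fix f n Q \<zeta> assume f: "f holomorphic_on G" and Q: "\<And>z. z \<in> K' \<Longrightarrow> norm (f z) \<le> Q" and \<zeta>: "\<zeta> \<in> K"
    have sub: "cball \<zeta> r \<subseteq> G" using K'_cball[OF \<zeta>] K'G by blast
    have "\<zeta> \<in> K'" using K'_cball[OF \<zeta>] r(1) by force
    then have "Q \<ge> 0" using Q[of \<zeta>] norm_ge_zero[of "f \<zeta>"] by linarith
    have term_le: "norm ((deriv ^^ j) f \<zeta> / fact j * (a * \<zeta>) ^ j) \<le> Q * B ^ n" if "j \<le> n" for j
    proof -
      have "norm ((deriv ^^ j) f \<zeta>) \<le> fact j * Q / r ^ j"
      proof (rule Cauchy_inequality)
        show "f holomorphic_on ball \<zeta> r" using f sub by (rule holomorphic_on_subset[OF _ order_trans[OF ball_subset_cball]])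
        show "continuous_on (cball \<zeta> r) f" by (rule holomorphic_on_imp_continuous_on[OF holomorphic_on_subset[OF f sub]])
        show "norm (f x) \<le> Q" if "norm (\<zeta> - x) = r" for x
          by (rule Q) (use K'_cball[OF \<zeta>] that in \<open>auto simp: dist_norm\<close>)
      qed (rule r)
      then have "norm ((deriv ^^ j) f \<zeta>) / fact j \<le> fact j * Q / r ^ j / fact j"
        by (rule divide_right_mono) simp
      then have 1: "norm ((deriv ^^ j) f \<zeta> / fact j) \<le> Q / r ^ j"
        by (simp add: norm_divide)
      have "norm ((deriv ^^ j) f \<zeta> / fact j * (a * \<zeta>) ^ j) \<le> Q / r ^ j * (norm a * R) ^ j"
        unfolding norm_mult norm_power
        by (intro mult_mono 1 power_mono mult_left_mono R \<zeta>) (use \<open>Q \<ge> 0\<close> r(1) in auto)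
      also have "\<dots> = Q * (norm a * R / r) ^ j" by (simp add: power_divide)
      also have "\<dots> \<le> Q * B ^ j"
      proof (intro mult_left_mono power_mono \<open>Q \<ge> 0\<close>)
        have "0 \<le> R" using R[OF \<zeta>] norm_ge_zero[of \<zeta>] by linarith
        then show "0 \<le> norm a * R / r" using r(1) by simp
      qed (simp add: B_def)
      also have "\<dots> \<le> Q * B ^ n"
        by (intro mult_left_mono power_increasing \<open>Q \<ge> 0\<close> that) (simp add: B_def)
      finally show ?thesis .
    qed
    have "\<zeta> \<in> G" using \<zeta> assms(3) by auto
    then have "norm (taylor_op G a n f \<zeta>) \<le> (\<Sum>j=0..n. Q * B ^ n)"
      unfolding taylor_op_def by (simp only: restrict_apply', intro order_trans[OF norm_sum] sum_mono term_le) simp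
    then show "norm (taylor_op G a n f \<zeta>) \<le> (real n + 1) * Q * B ^ n" by (simp add: algebra_simps)
  qed
qed

lemma taylor_op_in_hol_funs:
  assumes "open G" "f \<in> hol_funs G"
  shows "taylor_op G a n f \<in> hol_funs G"
  using holomorphic_taylor_op[OF assms(1) hol_funs_holomorphic[OF assms(2)]]
  by (simp add: hol_funs_def taylor_op_def)

lemma continuous_map_taylor_op:
  assumes G: "open G"
  shows "continuous_map (hol_topology G) (hol_topology G) (taylor_op G a n)"
  unfolding continuous_map openin_hol_topology topspace_hol_topology
proof (intro conjI allI impI)
  show "taylor_op G a n ` hol_funs G \<subseteq> hol_funs G"
    using taylor_op_in_hol_funs[OF G] by blast
  fix U assume U: "hol_open G U"
  show "hol_open G {f \<in> hol_funs G. taylor_op G a n f \<in> U}"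
    unfolding hol_open_def
  proof (intro conjI ballI)
    fix f assume "f \<in> {f \<in> hol_funs G. taylor_op G a n f \<in> U}"
    then have f: "f \<in> hol_funs G" "taylor_op G a n f \<in> U" by auto
    obtain K e where K: "compact K" "K \<subseteq> G" "e > 0"
      "\<And>g. g \<in> hol_funs G \<Longrightarrow> (\<And>z. z \<in> K \<Longrightarrow> norm (g z - taylor_op G a n f z) < e) \<Longrightarrow> g \<in> U"
      by (rule hol_openD[OF U f(2)]) auto
    obtain K' B where K': "compact K'" "K' \<subseteq> G" "B \<ge> 1"
      "\<And>f n Q \<zeta>. \<lbrakk>f holomorphic_on G; \<And>z. z \<in> K' \<Longrightarrow> norm (f z) \<le> Q; \<zeta> \<in> K\<rbrakk>
       \<Longrightarrow> norm (taylor_op G a n f \<zeta>) \<le> (real n + 1) * Q * B ^ n"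
      by (rule taylor_op_bound[OF G K(1,2), of a]) auto
    define A where "A = (real n + 1) * B ^ n"
    have A: "A > 0" using K'(3) by (simp add: A_def)
    define d where "d = e / (2 * A)"
    have "d > 0" using K(3) A by (simp add: d_def)
    have "g \<in> hol_funs G \<and> taylor_op G a n g \<in> U" if g: "g \<in> hol_funs G" "\<forall>z\<in>K'. dist (g z) (f z) < d" for g
    proof
      show "taylor_op G a n g \<in> U"
      proof (rule K(4))
        show "taylor_op G a n g \<in> hol_funs G" by (rule taylor_op_in_hol_funs[OF G g(1)])
        fix z assume z: "z \<in> K"
        then have zG: "z \<in> G" using K(2) by blast
        note hol = hol_funs_holomorphic[OF g(1)] hol_funs_holomorphic[OF f(1)]
        have "norm (taylor_op G a n (\<lambda>z. g z - f z) z) \<le> (real n + 1) * d * B ^ n"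
          by (rule K'(4)[OF holomorphic_on_diff[OF hol] _ z]) (use g(2) in \<open>auto simp: dist_norm less_imp_le\<close>)
        also have "\<dots> = A * d" by (simp add: A_def)
        also have "\<dots> < e" using A K(3) by (simp add: d_def)
        finally show "norm (taylor_op G a n g z - taylor_op G a n f z) < e"
          by (simp add: taylor_op_diff[OF G hol zG])
      qed
    qed (rule g)
    then show "\<exists>K e. compact K \<and> K \<subseteq> G \<and> e > 0 \<and>
        {g \<in> hol_funs G. \<forall>z\<in>K. dist (g z) (f z) < e} \<subseteq> {f \<in> hol_funs G. taylor_op G a n f \<in> U}"
      using K' \<open>d > 0\<close> by (intro exI[of _ K'] exI[of _ d]) auto
  qed auto
qed

lemma continuous_linear_op_D_op:
  assumes G: "open G"
  shows "continuous_linear_op (H_space G) (tvs_power (H_space G) s) (D_op G a s n)"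
  unfolding continuous_linear_op_def
proof (intro conjI ballI allI)
  show "continuous_map (tvs_top (H_space G)) (tvs_top (tvs_power (H_space G) s)) (D_op G a s n)"
    using continuous_map_taylor_op[OF G]
    by (simp add: H_space_def tvs_power_def continuous_map_componentwise D_op_def image_subset_iff)
  fix f assume "f \<in> topspace (tvs_top (H_space G))"
  then have f: "f holomorphic_on G"
    by (simp add: H_space_def topspace_hol_topology hol_funs_def)
  {
    fix g assume "g \<in> topspace (tvs_top (H_space G))"
    then have g: "g holomorphic_on G"
      by (simp add: H_space_def topspace_hol_topology hol_funs_def)
    have fg: "(\<lambda>z. f z + g z) holomorphic_on G" by (rule holomorphic_on_add[OF f g])
    have "taylor_op G a m (\<lambda>z\<in>G. f z + g z) = (\<lambda>\<zeta>\<in>G. taylor_op G a m f \<zeta> + taylor_op G a m g \<zeta>)" for m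
    proof -
      have "taylor_op G a m (\<lambda>z\<in>G. f z + g z) = taylor_op G a m (\<lambda>z. f z + g z)"
        by (rule taylor_op_cong[OF G hol_funs_holomorphic[OF restrict_in_hol_funs[OF fg]] fg]) simp
      also have "\<dots> = (\<lambda>\<zeta>\<in>G. taylor_op G a m f \<zeta> + taylor_op G a m g \<zeta>)"
      proof
        fix \<zeta> show "taylor_op G a m (\<lambda>z. f z + g z) \<zeta> = (\<lambda>\<zeta>\<in>G. taylor_op G a m f \<zeta> + taylor_op G a m g \<zeta>) \<zeta>"
          using taylor_op_add[OF G f g] by (cases "\<zeta> \<in> G") (simp_all add: taylor_op_def)
      qed
      finally show ?thesis .
    qed
    then show "D_op G a s n (tvs_add (H_space G) f g) =
        tvs_add (tvs_power (H_space G) s) (D_op G a s n f) (D_op G a s n g)"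
      by (simp add: D_op_def H_space_def tvs_power_def cong: restrict_cong)
  }
  fix c
  have cf: "(\<lambda>z. c * f z) holomorphic_on G" by (rule holomorphic_on_mult[OF holomorphic_on_const f])
  have "taylor_op G a m (\<lambda>z\<in>G. c * f z) = (\<lambda>\<zeta>\<in>G. c * taylor_op G a m f \<zeta>)" for m
  proof -
    have "taylor_op G a m (\<lambda>z\<in>G. c * f z) = taylor_op G a m (\<lambda>z. c * f z)"
      by (rule taylor_op_cong[OF G hol_funs_holomorphic[OF restrict_in_hol_funs[OF cf]] cf]) simp
    also have "\<dots> = (\<lambda>\<zeta>\<in>G. c * taylor_op G a m f \<zeta>)"
    proof
      fix \<zeta> show "taylor_op G a m (\<lambda>z. c * f z) \<zeta> = (\<lambda>\<zeta>\<in>G. c * taylor_op G a m f \<zeta>) \<zeta>"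
        using taylor_op_cmult[OF G f] by (cases "\<zeta> \<in> G") (simp_all add: taylor_op_def)
    qed
    finally show ?thesis .
  qed
  then show "D_op G a s n (tvs_scale (H_space G) c f) =
      tvs_scale (tvs_power (H_space G) s) c (D_op G a s n f)"
    by (simp add: D_op_def H_space_def tvs_power_def cong: restrict_cong)
qed

section \<open>Approximation by functions with prescribed Taylor sums\<close>

text \<open>
  The left side is at most \<open>(2 * B * (1/2) ^ N) ^ E\<close>, since \<open>k + 1 \<le> 2 ^ E\<close>. In the application \<open>k = n ^ j\<close>
  is the order of a Taylor sum and \<open>N * E\<close> with \<open>E = n ^ (i - 1) \<ge> n ^ j\<close> is the parameter of a step
  polynomial of the next scale.
\<close>

lemma geometric_beats_taylor_growth:
  fixes B :: real
  assumes B: "B \<ge> 1" and small: "2 * B * (1/2) ^ N \<le> 1" and "E \<ge> 1" "k \<le> E"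
  shows "(real k + 1) * B ^ k * (1/2) ^ (N * E) \<le> 2 * B * (1/2) ^ N"
proof -
  have "real (Suc E) \<le> real (2 ^ E)"
    using less_exp[of E] Suc_leI of_nat_le_iff by blast
  then have "real k + 1 \<le> 2 ^ E" using \<open>k \<le> E\<close> by simp
  moreover have "B ^ k \<le> B ^ E" using B \<open>k \<le> E\<close> by (rule power_increasing[rotated])
  ultimately have "(real k + 1) * B ^ k * (1/2) ^ (N * E) \<le> 2 ^ E * B ^ E * (1/2) ^ (N * E)"
    using B by (intro mult_right_mono mult_mono) auto
  also have "\<dots> = (2 * B * (1/2) ^ N) ^ E"
    by (simp add: power_mult power_mult_distrib)
  also have "\<dots> \<le> 2 * B * (1/2) ^ N"
    using power_decreasing[OF \<open>E \<ge> 1\<close>, of "2 * B * (1/2) ^ N"] small B by simp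
  finally show ?thesis .
qed

text \<open>
  The density statement outlined at the beginning. The polynomial \<open>P\<close> is \<open>p\<close> plus the blocks
  \<open>q i = (H i - H (i - 1)) * step_poly (m i) u\<close>. On \<open>L\<close> all blocks are small. On \<open>S = (a + 1) L\<close> the block
  \<open>q i\<close> is close to \<open>H i - H (i - 1)\<close>. The Taylor sum of order \<open>n ^ j\<close> evaluates the blocks \<open>i \<le> j\<close>
  exactly on \<open>S\<close> and nearly annihilates the blocks \<open>i > j\<close>.
\<close>

lemma simultaneous_taylor_approximation:
  assumes G: "open G" "simply_connected G" "G \<noteq> {}" "G \<inter> (\<lambda>z. (a + 1) * z) ` G = {}" and a: "a \<noteq> -1"
    and K: "compact K" "K \<subseteq> G" and f: "f holomorphic_on G" and e: "e > 0"
  obtains q n where "n \<ge> 1" "\<And>z. z \<in> K \<Longrightarrow> norm (poly q z - f z) < e"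
    "\<And>j z. j \<in> {1..s} \<Longrightarrow> z \<in> K \<Longrightarrow> norm (taylor_op G a (n ^ j) (poly q) z - poly (h j) z) < e"
proof -
  have a1: "a + 1 \<noteq> 0" using a by (simp add: add_eq_0_iff2)
  have "G \<noteq> UNIV" using G(4) by force
  obtain K' B where K': "compact K'" "K' \<subseteq> G" "B \<ge> 1"
    and Tbound: "\<And>f n Q \<zeta>. \<lbrakk>f holomorphic_on G; \<And>z. z \<in> K' \<Longrightarrow> norm (f z) \<le> Q; \<zeta> \<in> K\<rbrakk>
       \<Longrightarrow> norm (taylor_op G a n f \<zeta>) \<le> (real n + 1) * Q * B ^ n"
    by (rule taylor_op_bound[OF G(1) K, of a]) auto
  have KK': "compact (K \<union> K')" "K \<union> K' \<subseteq> G" using K K' by auto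
  obtain L where L: "compact L" "K \<union> K' \<subseteq> L" "L \<subseteq> G" "connected (- L)"
    and runge: "\<And>f T e. \<lbrakk>f holomorphic_on G; compact T; connected (- T); T \<inter> G = {}; e > 0\<rbrakk>
       \<Longrightarrow> \<exists>p. (\<forall>z\<in>L. norm (poly p z - f z) < e) \<and> (\<forall>z\<in>T. norm (poly p z) < e)"
    by (rule runge_simply_connected[OF G(1-3) \<open>G \<noteq> UNIV\<close> KK']) blast
  define S where "S = (\<lambda>z. (a + 1) * z) ` L"
  have cptS: "compact S"
    unfolding S_def by (intro compact_continuous_image L continuous_on_mult_left continuous_on_id)
  have "- S = (\<lambda>z. (a + 1) * z) ` (- L)"
  proof -
    have "bij (\<lambda>z. (a + 1) * z)"
      using a1 by (intro bij_betwI[of _ _ _ "\<lambda>z. z / (a + 1)"]) auto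
    then show ?thesis unfolding S_def by (simp add: bij_image_Compl_eq)
  qed
  then have connS: "connected (- S)"
    using connected_continuous_image[OF continuous_on_mult_left[OF continuous_on_id] L(4)] by simp
  have SG: "S \<inter> G = {}" using G(4) L(3) by (auto simp: S_def)
  obtain p where p: "\<And>z. z \<in> L \<Longrightarrow> norm (poly p z - f z) < e / 2"
    using runge[OF f cptS connS SG half_gt_zero[OF e]] by blast
  obtain v where v: "\<And>z. z \<in> L \<Longrightarrow> norm (poly v z - 1) < 1/16" "\<And>z. z \<in> S \<Longrightarrow> norm (poly v z) < 1/16"
    using runge[OF holomorphic_on_const cptS connS SG, of "1/16" 1] by auto
  \<comment> \<open>Runge's theorem prescribes the value \<open>0\<close> on \<open>S\<close>, so the indicator of \<open>S\<close> is obtained as a complement.\<close>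
  define u where "u = 1 - v"
  have u: "\<And>z. z \<in> L \<Longrightarrow> norm (poly u z) \<le> 1/16" "\<And>z. z \<in> S \<Longrightarrow> norm (poly u z - 1) \<le> 1/16"
    using v by (auto simp: u_def norm_minus_commute less_imp_le)
  define H where "H = (\<lambda>i. if i = 0 then p else pcompose (h i) [:0, 1 / (a + 1):])"
  define g where "g = (\<lambda>i. H i - H (i - 1))"
  have H: "poly (H j) ((a + 1) * z) = poly (h j) z" if "j \<ge> 1" for j z
    using that a1 by (simp add: H_def poly_pcompose)
  have "\<exists>M>0. \<forall>z\<in>L \<union> S. norm (poly (g i) z) \<le> M" for i
    by (rule poly_approximable_bounded[OF compact_Un[OF L(1) cptS] poly_approximable_poly[of _ "g i"]]) blast
  then obtain M' where M': "\<And>i. M' i > 0" "\<And>i z. z \<in> L \<union> S \<Longrightarrow> norm (poly (g i) z) \<le> M' i"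
    by metis
  define M where "M = (\<Sum>i\<in>{1..s}. M' i)"
  have M: "norm (poly (g i) z) \<le> M" if "i \<in> {1..s}" "z \<in> L \<union> S" for i z
  proof -
    have "M' i \<le> M" unfolding M_def by (rule member_le_sum) (use that M'(1) in \<open>auto intro: less_imp_le\<close>)
    then show ?thesis using M'(2)[OF that(2), of i] by linarith
  qed
  have M0: "M \<ge> 0" unfolding M_def by (rule sum_nonneg) (use M'(1) in \<open>auto intro: less_imp_le\<close>)
  define d where "d = degree p + (\<Sum>i\<in>{1..s}. degree (g i))"
  have dp: "degree p \<le> d" by (simp add: d_def)
  have dg: "degree (g i) \<le> d" if "i \<in> {1..s}" for i
  proof -
    have "degree (g i) \<le> (\<Sum>i\<in>{1..s}. degree (g i))" by (rule member_le_sum) (use that in auto)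
    then show ?thesis by (simp add: d_def)
  qed
  \<comment> \<open>One smallness condition on \<open>N\<close>, namely \<open>c * (1/2) ^ N < min 1 (e / 2)\<close>, yields both
    \<open>2 * B * (1/2) ^ N \<le> 1\<close> and \<open>s * \<delta> < e / 2\<close> for the common error bound \<open>\<delta>\<close> of the blocks below.\<close>
  define c where "c = 2 * B * (1 + real s * M)"
  have "(\<lambda>N. c * (1/2) ^ N) \<longlonglongrightarrow> c * 0"
    by (intro tendsto_mult_left LIMSEQ_power_zero) simp
  then have "\<forall>\<^sub>F N in sequentially. c * (1/2) ^ N < min 1 (e / 2)"
    by (rule order_tendstoD(2)) (use e in simp)
  then obtain N where N: "c * (1/2) ^ N < min 1 (e / 2)" "N \<ge> max 1 d"
    using eventually_happens'[OF _ eventually_conj[OF _ eventually_ge_at_top[of "max 1 d"]]] by (metis sequentially_bot)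
  define D where "D = max 1 (degree u)"
  \<comment> \<open>With this \<open>n\<close>, \<open>step_poly (m i) u\<close> has degree at most \<open>n ^ i / 2\<close>; the other half of the
    allowed degree is room for the factor \<open>g i\<close>.\<close>
  define n where "n = 4 * D * N"
  have n1: "n \<ge> 1" using N(2) by (simp add: n_def D_def)
  define m where "m = (\<lambda>i. N * n ^ (i - 1))"
  define q where "q = (\<lambda>i. g i * step_poly (m i) u)"
  define P where "P = p + (\<Sum>i\<in>{1..s}. q i)"
  define \<delta> where "\<delta> = M * (2 * B * (1/2) ^ N)"
  have "c * (1/2) ^ N = 2 * B * (1/2) ^ N + real s * \<delta>"
    by (simp add: c_def \<delta>_def algebra_simps)
  moreover have "0 \<le> real s * \<delta>" "0 \<le> 2 * B * (1/2) ^ N" using M0 K'(3) by (simp_all add: \<delta>_def)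
  ultimately have small: "2 * B * (1/2) ^ N \<le> 1" and s\<delta>: "real s * \<delta> < e / 2"
    using N(1) by auto
  have pow_n: "1 \<le> n ^ k" for k using n1 by simp
  have deg: "degree (q i) \<le> n ^ i" if i: "i \<in> {1..s}" for i
  proof -
    have "degree (q i) \<le> d + 2 * m i * degree u"
      unfolding q_def by (intro order_trans[OF degree_mult_le] add_mono dg i degree_step_poly_le)
    also have "\<dots> \<le> N * n ^ (i - 1) + 2 * m i * D"
    proof (intro add_mono mult_left_mono)
      have "d \<le> N * 1" using N(2) by simp
      also have "\<dots> \<le> N * n ^ (i - 1)" by (intro mult_left_mono pow_n) simp
      finally show "d \<le> N * n ^ (i - 1)" .
    qed (simp_all add: D_def)
    also have "\<dots> = (1 + 2 * D) * (N * n ^ (i - 1))" by (simp add: m_def algebra_simps)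
    also have "\<dots> \<le> (4 * D) * (N * n ^ (i - 1))" by (intro mult_right_mono) (simp_all add: D_def)
    also have "\<dots> = n * n ^ (i - 1)" by (simp add: n_def)
    also have "\<dots> = n ^ i" using i by (simp flip: power_Suc)
    finally show ?thesis .
  qed
  have half_m: "(1/2::real) ^ m i \<le> (1/2) ^ N" for i
    unfolding m_def by (rule power_decreasing) (use mult_left_mono[OF pow_n, of N "i - 1"] in simp_all)
  have half_\<delta>: "M * (1/2) ^ N \<le> \<delta>"
    unfolding \<delta>_def using K'(3) M0 by (intro mult_left_mono) simp_all
  have qL: "norm (poly (q i) z) \<le> M * (1/2) ^ m i" if "i \<in> {1..s}" "z \<in> L" for i z
    unfolding q_def poly_mult norm_mult
    by (intro mult_mono M norm_step_poly_near_0 u) (use that M0 in auto)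
  have qS: "norm (poly (q i) z - poly (g i) z) \<le> \<delta>" if "i \<in> {1..s}" "z \<in> S" for i z
  proof -
    have "poly (q i) z - poly (g i) z = poly (g i) z * (poly (step_poly (m i) u) z - 1)"
      by (simp add: q_def algebra_simps)
    also have "norm \<dots> \<le> M * (1/2) ^ m i"
      unfolding norm_mult by (intro mult_mono M norm_step_poly_near_1 u) (use that M0 in auto)
    also have "\<dots> \<le> M * (1/2) ^ N" by (intro mult_left_mono half_m M0)
    finally show ?thesis using half_\<delta> by linarith
  qed
  have qT: "norm (taylor_op G a (n ^ j) (poly (q i)) z) \<le> \<delta>"
    if i: "i \<in> {1..s}" and "j < i" and z: "z \<in> K" for i j z
  proof -
    have "norm (taylor_op G a (n ^ j) (poly (q i)) z) \<le> (real (n ^ j) + 1) * (M * (1/2) ^ m i) * B ^ (n ^ j)"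
    proof (rule Tbound[OF poly_holomorphic_on[OF holomorphic_on_ident] _ z])
      fix y assume "y \<in> K'"
      then show "norm (poly (q i) y) \<le> M * (1/2) ^ m i" using L(2) by (intro qL i) blast
    qed
    also have "\<dots> = M * ((real (n ^ j) + 1) * B ^ (n ^ j) * (1/2) ^ (N * n ^ (i - 1)))"
      by (simp add: m_def)
    also have "\<dots> \<le> M * (2 * B * (1/2) ^ N)"
    proof (intro mult_left_mono M0 geometric_beats_taylor_growth K'(3) small pow_n)
      show "n ^ j \<le> n ^ (i - 1)" using n1 \<open>j < i\<close> by (intro power_increasing) auto
    qed
    finally show ?thesis by (simp add: \<delta>_def)
  qed
  show ?thesis
  proof (rule that[OF n1, of P])
    fix z assume "z \<in> K"
    then have z: "z \<in> L" using L(2) by blast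
    have "norm (\<Sum>i\<in>{1..s}. poly (q i) z) \<le> (\<Sum>i\<in>{1..s}. \<delta>)"
    proof (intro order_trans[OF norm_sum] sum_mono)
      fix i assume "i \<in> {1..s}"
      then have "norm (poly (q i) z) \<le> M * (1/2) ^ m i" using z by (rule qL)
      also have "\<dots> \<le> M * (1/2) ^ N" by (intro mult_left_mono half_m M0)
      finally show "norm (poly (q i) z) \<le> \<delta>" using half_\<delta> by linarith
    qed
    then have "norm (\<Sum>i\<in>{1..s}. poly (q i) z) < e / 2" using s\<delta> by simp
    moreover have "poly P z - f z = (poly p z - f z) + (\<Sum>i\<in>{1..s}. poly (q i) z)"
      by (simp add: P_def poly_sum)
    moreover have "norm ((poly p z - f z) + (\<Sum>i\<in>{1..s}. poly (q i) z)) < e"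
      by (rule norm_triangle_lt) (use calculation(1) p[OF z] in linarith)
    ultimately show "norm (poly P z - f z) < e" by (simp only:)
  next
    fix j z assume j: "j \<in> {1..s}" and z: "z \<in> K"
    have zG: "z \<in> G" using z K(2) by blast
    define w where "w = (a + 1) * z"
    have wS: "w \<in> S" using z L(2) by (auto simp: w_def S_def)
    have "degree p \<le> n ^ j"
    proof -
      have "1 * N \<le> (4 * D) * N" by (intro mult_right_mono) (simp_all add: D_def)
      then have "d \<le> n" using N(2) unfolding n_def max.bounded_iff by linarith
      also have "\<dots> \<le> n ^ j" using j n1 by (intro self_le_power) auto
      finally show ?thesis using dp by linarith
    qed
    then have Tp: "taylor_op G a (n ^ j) (poly p) z = poly p w"
      unfolding w_def by (rule taylor_op_poly[OF _ zG])
    have hol: "poly r holomorphic_on G" for r by (rule poly_holomorphic_on[OF holomorphic_on_ident])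
    have "poly P = (\<lambda>z. poly p z + (\<Sum>i\<in>{1..s}. poly (q i) z))"
      by (auto simp: P_def poly_sum)
    then have TP: "taylor_op G a (n ^ j) (poly P) z = poly p w + (\<Sum>i\<in>{1..s}. taylor_op G a (n ^ j) (poly (q i)) z)"
      using taylor_op_add[OF G(1) hol[of p] holomorphic_on_sum[of "{1..s}" "\<lambda>i. poly (q i)", OF hol] zG, of a "n ^ j"]
        taylor_op_sum[OF G(1) finite_atLeastAtMost[of 1 s] hol[of "q _"] zG, of a "n ^ j"] Tp by (simp only:)
    have "(\<Sum>i\<in>{1..j}. poly (g i) w) = poly (H j) w - poly (H 0) w"
      using j sum_telescope''[of 0 j "\<lambda>i. poly (H i) w"] by (simp add: g_def)
    also have "\<dots> = poly (h j) z - poly p w" using j H[of j z] by (simp add: w_def H_def)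
    also have "(\<Sum>i\<in>{1..j}. poly (g i) w) = (\<Sum>i\<in>{1..s}. if i \<le> j then poly (g i) w else 0)"
      using j by (intro sum.mono_neutral_cong_left) auto
    finally have "taylor_op G a (n ^ j) (poly P) z - poly (h j) z =
      (\<Sum>i\<in>{1..s}. taylor_op G a (n ^ j) (poly (q i)) z - (if i \<le> j then poly (g i) w else 0))"
      by (simp add: TP sum_subtractf)
    also have "norm \<dots> \<le> (\<Sum>i\<in>{1..s}. \<delta>)"
    proof (intro order_trans[OF norm_sum] sum_mono)
      fix i assume i: "i \<in> {1..s}"
      show "norm (taylor_op G a (n ^ j) (poly (q i)) z - (if i \<le> j then poly (g i) w else 0)) \<le> \<delta>"
      proof (cases "i \<le> j")
        case True
        have "degree (q i) \<le> n ^ j"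
          using deg[OF i] power_increasing[OF True n1] by linarith
        then have "taylor_op G a (n ^ j) (poly (q i)) z = poly (q i) w"
          unfolding w_def by (rule taylor_op_poly[OF _ zG])
        then show ?thesis using qS[OF i wS] True by simp
      next
        case False
        then show ?thesis using qT[OF i _ z, of j] by simp
      qed
    qed
    also have "\<dots> < e" using s\<delta> e by simp
    finally show "norm (taylor_op G a (n ^ j) (poly P) z - poly (h j) z) < e" .
  qed
qed

section \<open>A countable dense set of polynomials and universality\<close>

text \<open>
  Polynomials with Gaussian rational coefficients, encoded by lists so that they inherit
  countability from the type of lists.
\<close>

definition gauss_poly :: "(rat \<times> rat) list \<Rightarrow> complex poly" where
  "gauss_poly xs = Poly (map (\<lambda>(x, y). Complex (of_rat x) (of_rat y)) xs)"

lemma gauss_rational_dense: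
  assumes "e > 0"
  obtains x y where "norm (Complex (of_rat x) (of_rat y) - c) < e"
proof -
  have e: "Re c < Re c + e / 2" "Im c < Im c + e / 2" using assms by auto
  obtain x where x: "Re c < of_rat x" "of_rat x < Re c + e / 2" using of_rat_dense[OF e(1)] by blast
  obtain y where y: "Im c < of_rat y" "of_rat y < Im c + e / 2" using of_rat_dense[OF e(2)] by blast
  have "norm (Complex (of_rat x) (of_rat y) - c) \<le> \<bar>of_rat x - Re c\<bar> + \<bar>of_rat y - Im c\<bar>"
    using cmod_le[of "Complex (of_rat x) (of_rat y) - c"] by simp
  also have "\<dots> < e" using x y by linarith
  finally show ?thesis by (rule that)
qed

lemma gauss_poly_dense:
  assumes K: "compact K" and "e > 0"
  shows "\<exists>xs. \<forall>z\<in>K. norm (poly (gauss_poly xs) z - poly p z) < e"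
  using \<open>e > 0\<close>
proof (induction p arbitrary: e rule: pCons_induct)
  case 0
  then show ?case by (intro exI[of _ "[]"]) (simp add: gauss_poly_def)
next
  case (pCons c p)
  obtain R where R: "R > 0" "\<And>z. z \<in> K \<Longrightarrow> norm z \<le> R"
    using compact_imp_bounded[OF K] unfolding bounded_pos by auto
  have "e / (2 * R) > 0" using pCons.prems R(1) by simp
  then obtain xs where xs: "\<And>z. z \<in> K \<Longrightarrow> norm (poly (gauss_poly xs) z - poly p z) < e / (2 * R)"
    using pCons.IH by metis
  obtain x y where xy: "norm (Complex (of_rat x) (of_rat y) - c) < e / 2"
    by (rule gauss_rational_dense[of "e / 2" c]) (use pCons.prems in auto)
  have "norm (poly (gauss_poly ((x, y) # xs)) z - poly (pCons c p) z) < e" if z: "z \<in> K" for z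
  proof -
    have eq: "poly (gauss_poly ((x, y) # xs)) z - poly (pCons c p) z =
      (Complex (of_rat x) (of_rat y) - c) + z * (poly (gauss_poly xs) z - poly p z)"
      by (simp add: gauss_poly_def right_diff_distrib)
    have "norm (z * (poly (gauss_poly xs) z - poly p z)) \<le> R * norm (poly (gauss_poly xs) z - poly p z)"
      unfolding norm_mult by (intro mult_right_mono R z) simp
    also have "\<dots> < R * (e / (2 * R))" by (intro mult_strict_left_mono xs z R)
    also have "\<dots> = e / 2" using R(1) by simp
    finally have "norm (z * (poly (gauss_poly xs) z - poly p z)) < e / 2" .
    then show ?thesis unfolding eq by (intro norm_triangle_lt) (use xy in linarith)
  qed
  then show ?case by (intro exI[of _ "(x, y) # xs"] ballI)
qed

theorem theorem3p1:
  fixes G :: "complex set" and \<sigma>\<^sub>0 :: nat and a :: complex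
  assumes "open G" and "connected G" and "G \<noteq> {}" and "simply_connected G"
    and "\<sigma>\<^sub>0 \<ge> 1"
    and "a \<noteq> -1"
    and "G \<inter> (\<lambda>z. (a + 1) * z) ` G = {}"
  shows "universal_seq (H_space G) (tvs_power (H_space G) \<sigma>\<^sub>0) (D_op G a \<sigma>\<^sub>0)"
proof -
  note G = \<open>open G\<close>
  define s where "s = \<sigma>\<^sub>0"
  obtain C where C: "\<And>n::nat. compact (C n)" "\<And>n. C n \<subseteq> G"
    "\<And>K. compact K \<Longrightarrow> K \<subseteq> G \<Longrightarrow> \<exists>N. \<forall>n\<ge>N. K \<subseteq> C n"
    using open_Union_compact_subsets[OF G] by metis
  have poly_hol: "poly p holomorphic_on A" for p :: "complex poly" and A
    by (rule poly_holomorphic_on[OF holomorphic_on_ident])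
  \<comment> \<open>The number \<open>k\<close> codes a list \<open>ls\<close> of target polynomials together with a level \<open>m\<close> that determines both the
    compact set \<open>C m\<close> and the tolerance. Entry \<open>0\<close> of \<open>ls\<close> is a dummy, as coordinates start at \<open>1\<close>.\<close>
  define close :: "nat \<Rightarrow> (rat \<times> rat) list list \<Rightarrow> nat \<Rightarrow> nat \<Rightarrow> (complex \<Rightarrow> complex) set" where
    "close = (\<lambda>m ls n i. {f \<in> hol_funs G. taylor_op G a (n ^ i) f \<in>
        {g \<in> hol_funs G. \<forall>z\<in>C m. norm (g z - poly (gauss_poly (ls ! i)) z) < 1 / real (Suc m)}})"
  define V where "V = (\<lambda>k. case from_nat k of (ls, m) \<Rightarrow> \<Union>n\<in>{1..}. \<Inter>i\<in>{1..s}. close m ls n i)"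
  have "hol_open G (V k)" for k
  proof -
    obtain ls m where k: "from_nat k = (ls :: (rat \<times> rat) list list, m :: nat)" 
      using prod.exhaust[of "from_nat k :: (rat \<times> rat) list list \<times> nat"] by blast
    have "openin (hol_topology G) (close m ls n i)" for n i
    proof -
      have "openin (hol_topology G) {g \<in> hol_funs G. \<forall>z\<in>C m. norm (g z - poly (gauss_poly (ls ! i)) z) < 1 / real (Suc m)}"
        unfolding openin_hol_topology
        by (rule hol_open_uniform_neighbourhood[OF C(1,2) holomorphic_on_imp_continuous_on[OF poly_hol]])
      from openin_continuous_map_preimage[OF continuous_map_taylor_op[OF G] this, of a "n ^ i"]
      show ?thesis unfolding close_def topspace_hol_topology .
    qed
    then have "openin (hol_topology G) (\<Inter>i\<in>{1..s}. close m ls n i)" for n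
      using \<open>\<sigma>\<^sub>0 \<ge> 1\<close> by (intro openin_INT2) (auto simp: s_def)
    then have "openin (hol_topology G) (\<Union>n\<in>{1..}. \<Inter>i\<in>{1..s}. close m ls n i)"
      by (intro openin_Union) auto
    then show ?thesis by (simp add: V_def k openin_hol_topology)
  qed
  moreover have "\<exists>g\<in>V k. \<forall>z\<in>K. norm (g z - f z) < e"
    if f: "f \<in> hol_funs G" and K: "compact K" "K \<subseteq> G" and e: "e > 0" for k f K e
  proof -
    obtain ls m where k: "from_nat k = (ls :: (rat \<times> rat) list list, m :: nat)" 
      using prod.exhaust[of "from_nat k :: (rat \<times> rat) list list \<times> nat"] by blast
    have KC: "compact (K \<union> C m)" "K \<union> C m \<subseteq> G" using K C by auto
    have "min e (1 / real (Suc m)) > 0" using e by simp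
    then obtain q n where n: "n \<ge> 1" and q: "\<And>z. z \<in> K \<union> C m \<Longrightarrow> norm (poly q z - f z) < min e (1 / real (Suc m))"
      and Tq: "\<And>j z. j \<in> {1..s} \<Longrightarrow> z \<in> K \<union> C m \<Longrightarrow>
        norm (taylor_op G a (n ^ j) (poly q) z - poly (gauss_poly (ls ! j)) z) < min e (1 / real (Suc m))"
      by (rule simultaneous_taylor_approximation[OF assms(1,4,3,7,6) KC hol_funs_holomorphic[OF f],
            where h = "\<lambda>j. gauss_poly (ls ! j)" and s = s]) blast
    define g where "g = restrict (poly q) G"
    have g: "g \<in> hol_funs G" unfolding g_def by (rule restrict_in_hol_funs[OF poly_hol])
    have Tg: "taylor_op G a l g = taylor_op G a l (poly q)" for l
      by (rule taylor_op_cong[OF G hol_funs_holomorphic[OF g] poly_hol]) (simp add: g_def)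
    have Tin: "taylor_op G a l (poly q) \<in> hol_funs G" for l
      using taylor_op_in_hol_funs[OF G g, of a l] unfolding Tg .
    have "g \<in> close m ls n i" if "i \<in> {1..s}" for i
      using Tq[OF that] Tin g unfolding close_def by (simp add: Tg)
    then have "g \<in> (\<Inter>i\<in>{1..s}. close m ls n i)" by blast
    then have "g \<in> V k" using n unfolding V_def k prod.case by blast
    moreover have "norm (g z - f z) < e" if "z \<in> K" for z
      using q[of z] that K(2) by (auto simp: g_def)
    ultimately show ?thesis by blast
  qed
  ultimately have "\<exists>f\<in>hol_funs G. \<forall>k. f \<in> V k" by (rule baire_hol_open[OF G])
  then obtain f where f: "f \<in> hol_funs G" "\<And>k. f \<in> V k" by blast
  let ?Y = "product_topology (\<lambda>_. hol_topology G) {1..s}"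
  have "?Y closure_of {D_op G a s n f | n. n \<ge> 1} = topspace ?Y"
  proof (intro equalityI subsetI closure_of_subset_topspace[THEN subsetD])
    fix y assume y: "y \<in> topspace ?Y"
    show "y \<in> ?Y closure_of {D_op G a s n f | n. n \<ge> 1}"
      unfolding in_closure_of
    proof (intro conjI allI impI y)
      fix W assume W: "y \<in> W \<and> openin ?Y W"
      then obtain U where U: "\<And>i. i \<in> {1..s} \<Longrightarrow> hol_open G (U i)" "y \<in> Pi\<^sub>E {1..s} U" "Pi\<^sub>E {1..s} U \<subseteq> W"
        unfolding openin_product_topology_alt openin_hol_topology by meson
      define nb where "nb = (\<lambda>i K (e::real). compact K \<and> K \<subseteq> G \<and> e > 0 \<and>
          (\<forall>g\<in>hol_funs G. (\<forall>z\<in>K. norm (g z - y i z) < e) \<longrightarrow> g \<in> U i))"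
      have "\<exists>K e. nb i K e" if i: "i \<in> {1..s}" for i
      proof -
        have "y i \<in> U i" using U(2) i by blast
        from U(1)[OF i] this show ?thesis
        proof (rule hol_openD)
          fix K e
          assume "compact K" "K \<subseteq> G" "e > (0::real)"
            "\<And>g. g \<in> hol_funs G \<Longrightarrow> (\<And>z. z \<in> K \<Longrightarrow> norm (g z - y i z) < e) \<Longrightarrow> g \<in> U i"
          then have "nb i K e" by (simp add: nb_def)
          then show ?thesis by blast
        qed
      qed
      then obtain K e where "\<And>i. i \<in> {1..s} \<Longrightarrow> nb i (K i) (e i)" by metis
      then have K: "compact (K i)" "K i \<subseteq> G" "e i > 0"
          "\<And>g. \<lbrakk>g \<in> hol_funs G; \<forall>z\<in>K i. norm (g z - y i z) < e i\<rbrakk> \<Longrightarrow> g \<in> U i"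
        if "i \<in> {1..s}" for i
        using that by (simp_all add: nb_def)
      have "compact (\<Union>i\<in>{1..s}. K i)" by (intro compact_UN) (use K(1) in auto)
      moreover have "(\<Union>i\<in>{1..s}. K i) \<subseteq> G" using K(2) by blast
      ultimately obtain m0 where m0: "\<And>n. n \<ge> m0 \<Longrightarrow> (\<Union>i\<in>{1..s}. K i) \<subseteq> C n" using C(3) by blast
      define \<epsilon> where "\<epsilon> = Min (e ` {1..s})"
      have ne: "e ` {1..s} \<noteq> {}" using \<open>\<sigma>\<^sub>0 \<ge> 1\<close> by (simp add: s_def)
      have "\<epsilon> > 0" unfolding \<epsilon>_def using K(3) ne by (subst Min_gr_iff) auto
      have \<epsilon>: "\<epsilon> \<le> e i" if "i \<in> {1..s}" for i unfolding \<epsilon>_def by (rule Min_le) (use that in auto)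
      obtain m1 where m1: "inverse (real (Suc m1)) < \<epsilon> / 2"
        using reals_Archimedean[of "\<epsilon> / 2"] \<open>\<epsilon> > 0\<close> by auto
      define m where "m = max m0 m1"
      have "1 / real (Suc m) \<le> inverse (real (Suc m1))"
        unfolding inverse_eq_divide by (rule divide_left_mono) (simp_all add: m_def)
      then have m: "1 / real (Suc m) < \<epsilon> / 2" using m1 by linarith
      have "\<exists>xs. \<forall>z\<in>C m. norm (poly (gauss_poly xs) z - y i z) < \<epsilon> / 2" if i: "i \<in> {1..s}" for i
      proof -
        have yi: "y i holomorphic_on G"
          using y i by (auto simp: topspace_hol_topology hol_funs_def PiE_iff)
        have "G \<noteq> UNIV" using assms(7) by force
        have e4: "\<epsilon> / 4 > 0" using \<open>\<epsilon> > 0\<close> by simp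
        obtain p where p: "\<And>z. z \<in> C m \<Longrightarrow> norm (poly p z - y i z) < \<epsilon> / 4"
        proof (rule runge_simply_connected[OF G assms(4,3) \<open>G \<noteq> UNIV\<close> C(1,2)[of m]], goal_cases)
          case (1 L)
          then have "\<exists>p. (\<forall>z\<in>L. norm (poly p z - y i z) < \<epsilon> / 4) \<and> (\<forall>z\<in>{}. norm (poly p z) < \<epsilon> / 4)"
            by (intro 1(6) yi e4) (auto simp: connected_UNIV)
          then show ?case using 1(1,3) by blast
        qed
        obtain xs where xs: "\<And>z. z \<in> C m \<Longrightarrow> norm (poly (gauss_poly xs) z - poly p z) < \<epsilon> / 4"
          using gauss_poly_dense[OF C(1) e4] by blast
        have "norm (poly (gauss_poly xs) z - y i z) < \<epsilon> / 2" if "z \<in> C m" for z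
          using norm_triangle_lt[of "poly (gauss_poly xs) z - poly p z" "poly p z - y i z" "\<epsilon> / 2"] p[OF that] xs[OF that]
          by simp
        then show ?thesis by blast
      qed
      then obtain X where X: "\<And>i z. i \<in> {1..s} \<Longrightarrow> z \<in> C m \<Longrightarrow> norm (poly (gauss_poly (X i)) z - y i z) < \<epsilon> / 2"
        by metis
      define ls where "ls = map X [0..<Suc s]"
      have ls: "ls ! i = X i" if "i \<in> {1..s}" for i
        using that unfolding ls_def by (subst nth_map) (auto simp del: upt_Suc)
      have "f \<in> V (to_nat (ls, m))" by (rule f(2))
      then obtain n where n: "n \<ge> 1" "\<And>i. i \<in> {1..s} \<Longrightarrow> f \<in> close m ls n i"
        unfolding V_def by auto
      have "taylor_op G a (n ^ i) f \<in> U i" if i: "i \<in> {1..s}" for i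
      proof -
        have "norm (taylor_op G a (n ^ i) f z - y i z) < e i" if "z \<in> K i" for z
        proof -
          have "m0 \<le> m" by (simp add: m_def)
          then have z: "z \<in> C m" using m0 that i by blast
          then have "norm (taylor_op G a (n ^ i) f z - poly (gauss_poly (X i)) z) < 1 / real (Suc m)"
            using n(2)[OF i] ls[OF i] by (simp add: close_def)
          then have "norm ((taylor_op G a (n ^ i) f z - poly (gauss_poly (X i)) z) + (poly (gauss_poly (X i)) z - y i z)) < e i"
            by (intro norm_triangle_lt) (use m X[OF i z] \<epsilon>[OF i] in linarith)
          then show ?thesis by simp
        qed
        then show ?thesis by (intro K(4)[OF i] taylor_op_in_hol_funs[OF G f(1)] ballI)
      qed
      then have "D_op G a s n f \<in> W" using U(3) by (auto simp: D_op_def)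
      then show "\<exists>x. x \<in> {D_op G a s n f | n. n \<ge> 1} \<and> x \<in> W" using n(1) by blast
    qed
  qed
  then have "tvs_top (tvs_power (H_space G) s) closure_of {D_op G a s n f | n. n \<ge> 1}
      = topspace (tvs_top (tvs_power (H_space G) s))"
    by (simp add: tvs_power_def H_space_def)
  moreover have "f \<in> topspace (tvs_top (H_space G))"
    using f(1) by (simp add: H_space_def topspace_hol_topology)
  ultimately show ?thesis
    unfolding universal_seq_def s_def using continuous_linear_op_D_op[OF G] by blast
qed

end
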